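(* Let $m\ge -1$ be real, let $p,q$ be real numbers with $6\le p\le q$, and let $r\in\mathbb{R}$. Then $$\|1+rbz\|_{L^q(\mathbb{S}^1,\,d\nu_m)}\ \le\ \|1+bz\|_{L^p(\mathbb{S}^1,\,d\nu_m)}\qquad\text{for all } b\in\mathbb{R}$$ if and only if $|r|\le\sqrt{\frac{p+m}{q+m}}$.
   Context: $\mathbb{S}^1=\{z\in\mathbb{C}:|z|=1\}$ is the unit circle, and $1+bz$ denotes the complex-valued function $z\mapsto 1+bz$ on $\mathbb{S}^1$. For real $m>-1$, $\nu_m$ is the ultraspherical probability measure on $\mathbb{S}^1$ given by $d\nu_m(z)=c_m|\sin\theta|^m\,d\theta$ for $z=e^{i\theta}$, $\theta\in[0,2\pi)$, where $c_m=\frac{\Gamma(m/2+1)}{2\,\Gamma(1/2)\,\Gamma(m/2+1/2)}$, so that $\nu_m(\mathbb{S}^1)=1$. For $m=-1$, $\nu_{-1}=\frac12(\delta_{-1}+\delta_1)$, where $\delta_w$ is the unit point mass at $w$. For $s>0$, $\|f\|_{L^s(\mathbb{S}^1,d\nu_m)}=\left(\int_{\mathbb{S}^1}|f(z)|^s\,d\nu_m(z)\right)^{1/s}$. *)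

theory Defs
  imports "HOL-Analysis.Analysis"
begin

abbreviation borel_circle :: "complex measure" where
  "borel_circle \<equiv> restrict_space borel (sphere 0 1)"

definition ultraspherical_const :: "real \<Rightarrow> real" where
  "ultraspherical_const m = Gamma (m / 2 + 1) / (2 * Gamma (1 / 2) * Gamma (m / 2 + 1 / 2))"

(* The endpoint measure is (delta_{-1} + delta_1) / 2, obtained by pushing the uniform
   probability measure on {-1, 1} forward to the Borel sets of the circle; see
   emeasure_ultraspherical_minus_one below.
   In the density, 0 powr m = 0 for every m (also for m \<le> 0); this affects only the
   null set of angles where sin t = 0. For m < -1 the definition has no meaning. *)
definition ultraspherical :: "real \<Rightarrow> complex measure" where
  "ultraspherical m =
     (if m = -1 then distr (uniform_count_measure {-1, 1}) borel_circle (\<lambda>z. z)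
      else distr
             (density (restrict_space lborel {0..<2 * pi})
                (\<lambda>t. ennreal (ultraspherical_const m * \<bar>sin t\<bar> powr m)))
             borel_circle cis)"

(* Real-valued, hence meaningful only when the s-th power of the modulus of f is integrable
   (the Bochner integral is 0 otherwise), in particular for bounded measurable f and s > 0. *)
definition Lnorm :: "real \<Rightarrow> complex measure \<Rightarrow> (complex \<Rightarrow> complex) \<Rightarrow> real" where
  "Lnorm s M f = (\<integral>z. norm (f z) powr s \<partial>M) powr (1 / s)"

lemma space_ultraspherical [simp]: "space (ultraspherical m) = sphere 0 1"
  by (simp add: ultraspherical_def space_restrict_space)

lemma sets_ultraspherical [simp, measurable_cong]:
  "sets (ultraspherical m) = sets borel_circle"
  by (simp add: ultraspherical_def)

lemma emeasure_ultraspherical_minus_one: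
  assumes A: "A \<in> sets borel_circle"
  shows "emeasure (ultraspherical (-1)) A
    = ennreal ((indicator A (-1) + indicator A 1) / 2)"
proof -
  have "emeasure (ultraspherical (-1)) A
      = emeasure (uniform_count_measure {-1, 1 :: complex}) (A \<inter> {-1, 1})"
    using A unfolding ultraspherical_def
    by (subst if_P, simp, subst emeasure_distr)
       (auto simp: measurable_def space_restrict_space space_uniform_count_measure
         sets_uniform_count_measure)
  also have "\<dots> = ennreal (card (A \<inter> {-1, 1}) / 2)"
    by (subst emeasure_uniform_count_measure) auto
  also have "real (card (A \<inter> {-1, 1})) = indicator A (-1) + indicator A 1"
    by (cases "1 \<in> A"; cases "-1 \<in> A") (simp_all add: Int_insert_right)
  finally show ?thesis .
qed

lemma emeasure_ultraspherical:
  assumes "m \<noteq> -1" and A: "A \<in> sets borel_circle"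
  shows "emeasure (ultraspherical m) A
    = (\<integral>\<^sup>+t\<in>{0..<2 * pi}.
         ennreal (ultraspherical_const m * \<bar>sin t\<bar> powr m) * indicator A (cis t) \<partial>lborel)"
proof -
  let ?N = "restrict_space lborel {0..<2 * pi}"
  let ?w = "\<lambda>t. ennreal (ultraspherical_const m * \<bar>sin t\<bar> powr m)"
  have cis_borel: "cis \<in> borel_measurable borel"
    by (intro borel_measurable_continuous_onI continuous_intros)
  have cis_circle: "cis \<in> measurable ?N borel_circle"
    by (intro measurable_restrict_space2 measurable_restrict_space1) (use cis_borel in auto)
  have w: "?w \<in> borel_measurable ?N"
    by (intro measurable_restrict_space1) measurable
  have pre: "cis -` A \<inter> space ?N \<in> sets ?N"
    using measurable_sets[OF cis_circle A] .
  have "emeasure (ultraspherical m) A = emeasure (density ?N ?w) (cis -` A \<inter> space ?N)"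
    using assms cis_circle by (simp add: ultraspherical_def emeasure_distr)
  also have "\<dots> = (\<integral>\<^sup>+t. ?w t * indicator (cis -` A \<inter> space ?N) t \<partial>?N)"
    by (rule emeasure_density[OF w pre])
  also have "\<dots> = (\<integral>\<^sup>+t. ?w t * indicator A (cis t) \<partial>?N)"
    by (intro nn_integral_cong) (auto split: split_indicator)
  also have "\<dots> = (\<integral>\<^sup>+t\<in>{0..<2 * pi}. ?w t * indicator A (cis t) \<partial>lborel)"
    by (rule nn_integral_restrict_space) simp
  finally show ?thesis .
qed

end

theory Submission
  imports Defs "HOL-Probability.Probability_Measure"
begin

text \<open>
  Write $V = |1 + bz|^2 = 1 + b^2 + 2b\,\mathrm{Re}\,z$ and $A_a(b) = \int V^a\,d\nu_m$, so that the
  $s$-norm of $1 + bz$ is $A_{s/2}(b)^{1/s}$. Sufficiency says that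
  $s \mapsto \frac1s \ln A_{s/2}(\sqrt{x/(s+m)})$ is nonincreasing for every $x > 0$. Where the
  argument is below $1$, the sign of the derivative is a logarithmic Sobolev inequality for $V^a$;
  where it is above $1$, it follows from the case below $1$ because $|1 + bz| = b\,|1 + z/b|$
  on the circle.

  The weight $|\sin\theta|^m$ enters only through Stein's identity
  $(m+1)\int xV^a = 2ab\int(1-x^2)V^{a-1}$ (with $x = \mathrm{Re}\,z$) and through the symmetry
  $x \mapsto -x$; both also hold for $m = -1$. They give
  $b A_a' = a(A_a - (1-b^2)A_{a-1})$ and a three-term recurrence in $a$, hence a Riccati equation in
  $b$ for $t = A_a/((1-b^2)A_{a-1})$.

  For the logarithmic Sobolev inequality, let $D$ be the difference of its two sides. As
  $D(0) = D'(0) = 0$, it is enough that the radial Laplacian $D'' + \frac{m+1}{b}D'$ is nonnegative.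
  Jensen's inequality removes the entropy term from it. What is left is a positive multiple of a
  function of $b$ that vanishes at $0$ and whose derivative is a rational function of $t$ and
  $K = (1+b^2)/(1-b^2)$; a barrier argument for the Riccati equation confines $t$ to a region where
  that function is nonnegative. Necessity is the second-order expansion at $b = 0$.
\<close>

text \<open>The path b = sqrt (x / (s + m)) is dictated by the claim: its values at s = q and s = p
  have the ratio sqrt ((p + m) / (q + m)). Differentiating along it produces the constant a^2 / (m +
  2a), with a = s / 2, of \<open>log_Sobolev\<close>. With this constant both sides agree at order
  b^2, so no estimate may lose anything at b = 0; this is why barriers starting from the value 0
  replace cruder bounds. The dimension behind the Laplacian is m + 2: for integer m >= 0, Re z under
  nu_m is distributed like a coordinate of a uniform point on the unit sphere of R^(m+2). Let U = V
  / (1 - b^2), the reciprocal of a Poisson kernel. Then K is the mean of U, t is the mean of U under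
  the weight U^(a-1), and U lies in [y, 1/y] for y = (1 - b) / (1 + b), where y + 1/y = 2K. The
  region for t thus comes from three sources: K <= t by correlation, t <= 1/y by the range of U, and
  a relation between the ratios for a and a - 1, which is the barrier. The barrier uses K <= t also
  at exponent a - 1, and this asks for a >= 2, that is s >= 4.\<close>

subsection \<open>Differentiation under the integral sign\<close>

text \<open>The mean value inequality bounds every difference quotient by \<open>C\<close>, which is
  integrable because the measure is finite; dominated convergence along sequences tending to
  \<open>y0\<close> does the rest.\<close>

lemma (in finite_measure) has_real_derivative_integral_bounded:
  fixes f f' :: "real \<Rightarrow> 'a \<Rightarrow> real"
  assumes "0 < d"
    and der: "\<And>y x. \<bar>y - y0\<bar> < d \<Longrightarrow> x \<in> space M \<Longrightarrow> ((\<lambda>y. f y x) has_real_derivative f' y x) (at y)"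
    and int: "\<And>y. \<bar>y - y0\<bar> < d \<Longrightarrow> integrable M (f y)"
    and meas: "f' y0 \<in> borel_measurable M"
    and bound: "\<And>y x. \<bar>y - y0\<bar> < d \<Longrightarrow> x \<in> space M \<Longrightarrow> \<bar>f' y x\<bar> \<le> C"
  shows "((\<lambda>y. \<integral>x. f y x \<partial>M) has_real_derivative (\<integral>x. f' y0 x \<partial>M)) (at y0)"
  unfolding has_field_derivative_iff tendsto_at_iff_sequentially o_def
proof (intro allI impI)
  fix Y :: "nat \<Rightarrow> real"
  assume ne: "\<forall>i. Y i \<in> UNIV - {y0}" and lim: "Y \<longlonglongrightarrow> y0"
  obtain N where N: "\<And>n. n \<ge> N \<Longrightarrow> \<bar>Y n - y0\<bar> < d"
    using lim \<open>0 < d\<close> unfolding lim_sequentially dist_real_def by blast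
  \<comment> \<open>Dropping the first \<open>N\<close> terms moves the whole sequence into the
    interval where the hypotheses hold.\<close>
  define Z where "Z n = Y (n + N)" for n
  have Z: "\<bar>Z n - y0\<bar> < d" "Z n \<noteq> y0" for n
    using N ne by (auto simp: Z_def)
  have limZ: "Z \<longlonglongrightarrow> y0"
    unfolding Z_def using lim by (rule LIMSEQ_ignore_initial_segment)
  have "(\<lambda>n. \<integral>x. (f (Z n) x - f y0 x) / (Z n - y0) \<partial>M) \<longlonglongrightarrow> (\<integral>x. f' y0 x \<partial>M)"
  proof (rule integral_dominated_convergence[where w = "\<lambda>_. C"])
    show "f' y0 \<in> borel_measurable M" by fact
    show "(\<lambda>x. (f (Z n) x - f y0 x) / (Z n - y0)) \<in> borel_measurable M" for n
      using int[OF Z(1)] int[of y0] \<open>0 < d\<close> by (auto intro!: borel_measurable_divide borel_measurable_diff)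
    show "integrable M (\<lambda>_. C)" by simp
    show "AE x in M. (\<lambda>n. (f (Z n) x - f y0 x) / (Z n - y0)) \<longlonglongrightarrow> f' y0 x"
    proof (rule AE_I2)
      fix x assume "x \<in> space M"
      then have "((\<lambda>y. (f y x - f y0 x) / (y - y0)) \<longlongrightarrow> f' y0 x) (at y0)"
        using der[of y0 x] \<open>0 < d\<close> by (simp add: has_field_derivative_iff)
      then show "(\<lambda>n. (f (Z n) x - f y0 x) / (Z n - y0)) \<longlonglongrightarrow> f' y0 x"
        unfolding tendsto_at_iff_sequentially o_def using Z limZ by auto
    qed
    show "AE x in M. norm ((f (Z n) x - f y0 x) / (Z n - y0)) \<le> C" for n
    proof (rule AE_I2)
      fix x assume x: "x \<in> space M"
      have "norm (f (Z n) x - f y0 x) \<le> C * norm (Z n - y0)"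
      proof (rule field_differentiable_bound[where S = "ball y0 d" and f' = "\<lambda>y. f' y x"])
        show "((\<lambda>y. f y x) has_real_derivative f' y x) (at y within ball y0 d)" if "y \<in> ball y0 d" for y
          using der[of y x] that x by (auto simp: dist_real_def abs_minus_commute intro: has_field_derivative_at_within)
        show "norm (f' y x) \<le> C" if "y \<in> ball y0 d" for y
          using bound[of y x] that x by (auto simp: dist_real_def abs_minus_commute)
      qed (use Z \<open>0 < d\<close> in \<open>auto simp: dist_real_def abs_minus_commute\<close>)
      then show "norm ((f (Z n) x - f y0 x) / (Z n - y0)) \<le> C"
        using Z(2)[of n] by (simp add: field_simps)
    qed
  qed
  also have "(\<lambda>n. \<integral>x. (f (Z n) x - f y0 x) / (Z n - y0) \<partial>M)
      = (\<lambda>n. ((\<integral>x. f (Z n) x \<partial>M) - (\<integral>x. f y0 x \<partial>M)) / (Z n - y0))"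
    using int Z \<open>0 < d\<close> by (simp add: Bochner_Integration.integral_diff)
  finally show "(\<lambda>i. ((\<integral>x. f (Y i) x \<partial>M) - (\<integral>x. f y0 x \<partial>M)) / (Y i - y0)) \<longlonglongrightarrow> (\<integral>x. f' y0 x \<partial>M)"
    unfolding Z_def by (rule LIMSEQ_offset)
qed

subsection \<open>Moments of the squared modulus\<close>

definition V :: "real \<Rightarrow> complex \<Rightarrow> real" where
  "V b z = 1 + b\<^sup>2 + 2 * b * Re z"

lemma abs_Re_sphere: "norm z = 1 \<Longrightarrow> \<bar>Re z\<bar> \<le> 1"
  using abs_Re_le_cmod[of z] by simp

lemma V_eq_norm: "norm z = 1 \<Longrightarrow> V b z = (norm (1 + complex_of_real b * z))\<^sup>2"
proof -
  assume "norm z = 1"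
  then have "(Re z)\<^sup>2 + (Im z)\<^sup>2 = 1" by (simp add: cmod_def)
  moreover have "(norm (1 + complex_of_real b * z))\<^sup>2 = 1 + 2 * b * Re z + b\<^sup>2 * ((Re z)\<^sup>2 + (Im z)\<^sup>2)"
    unfolding cmod_power2 by (simp add: power2_eq_square algebra_simps)
  ultimately show ?thesis by (simp add: V_def)
qed

lemma V_bounds:
  assumes "norm z = 1"
  shows "(1 - \<bar>b\<bar>)\<^sup>2 \<le> V b z" "V b z \<le> (1 + \<bar>b\<bar>)\<^sup>2"
proof -
  have "\<bar>b * Re z\<bar> \<le> \<bar>b\<bar>"
    using abs_Re_sphere[OF assms] mult_left_mono[of "\<bar>Re z\<bar>" 1 "\<bar>b\<bar>"] by (simp add: abs_mult)
  then show "(1 - \<bar>b\<bar>)\<^sup>2 \<le> V b z" "V b z \<le> (1 + \<bar>b\<bar>)\<^sup>2"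
    by (auto simp: V_def power2_eq_square algebra_simps)
qed

lemma V_nonneg: "norm z = 1 \<Longrightarrow> 0 \<le> V b z"
  by (simp add: V_eq_norm)

lemma V_pos: "norm z = 1 \<Longrightarrow> \<bar>b\<bar> < 1 \<Longrightarrow> 0 < V b z"
  using V_bounds(1)[of z b] by (smt (verit) zero_less_power2)

lemma continuous_on_V [continuous_intros]:
  assumes "continuous_on S f" "continuous_on S g"
  shows "continuous_on S (\<lambda>x. V (f x) (g x))"
  unfolding V_def using assms by (intro continuous_intros)

text \<open>The side conditions keep powers harmless. Stein's identity is wanted for every real
  \<open>a\<close>, so it asks for \<open>b < 1\<close>, where \<open>V\<close> is bounded away from
  0. Reflection is wanted for every \<open>b\<close>, including 1 and -1 where \<open>V\<close> has
  a zero, so it asks for \<open>0 < a\<close>.\<close>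

locale circle_measure = prob_space M for M :: "complex measure" +
  fixes m :: real
  assumes sets_M [measurable_cong]: "sets M = sets borel_circle"
    and m_ge: "-1 \<le> m"
    and stein: "\<And>a b. 0 \<le> b \<Longrightarrow> b < 1 \<Longrightarrow>
      (m + 1) * (\<integral>z. Re z * V b z powr a \<partial>M) = 2 * a * b * (\<integral>z. (1 - (Re z)\<^sup>2) * V b z powr (a - 1) \<partial>M)"
    and reflect: "\<And>a b. 0 < a \<Longrightarrow> (\<integral>z. V (- b) z powr a \<partial>M) = (\<integral>z. V b z powr a \<partial>M)"
begin

lemma space_M: "space M = sphere 0 1"
  using sets_eq_imp_space_eq[OF sets_M] by (simp add: space_restrict_space)

lemma meas_continuous: "continuous_on (sphere 0 1) f \<Longrightarrow> f \<in> borel_measurable M" for f :: "complex \<Rightarrow> real"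
  by (subst measurable_cong_sets[OF sets_M refl]) (rule borel_measurable_continuous_on_restrict)

lemma integrable_continuous:
  fixes f :: "complex \<Rightarrow> real"
  assumes "continuous_on (sphere 0 1) f"
  shows "integrable M f"
proof -
  have "bounded (f ` sphere 0 1)"
    using assms by (intro compact_imp_bounded compact_continuous_image) auto
  then obtain C where "\<And>z. norm z = 1 \<Longrightarrow> norm (f z) \<le> C"
    unfolding bounded_iff by force
  then show ?thesis
    using meas_continuous[OF assms] by (intro integrable_const_bound[where B = C]) (auto simp: space_M)
qed

lemma has_real_derivative_integral_circle:
  fixes f f' :: "real \<Rightarrow> complex \<Rightarrow> real"
  assumes "l < y0" "y0 < h"
    and der: "\<And>y z. l < y \<Longrightarrow> y < h \<Longrightarrow> z \<in> sphere 0 1 \<Longrightarrow> ((\<lambda>y. f y z) has_real_derivative f' y z) (at y)"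
    and cf: "\<And>y. l < y \<Longrightarrow> y < h \<Longrightarrow> continuous_on (sphere 0 1) (f y)"
    and cf': "continuous_on ({l<..<h} \<times> sphere 0 1) (\<lambda>p. f' (fst p) (snd p))"
  shows "((\<lambda>y. \<integral>z. f y z \<partial>M) has_real_derivative (\<integral>z. f' y0 z \<partial>M)) (at y0)"
proof -
  \<comment> \<open>Half the distance to the nearer end: the closed interval of radius
    \<open>d\<close> stays inside (l, h), and compactness of its product with the circle bounds
    \<open>f'\<close>.\<close>
  define d where "d = min (y0 - l) (h - y0) / 2"
  have d: "0 < d" "\<And>y. \<bar>y - y0\<bar> \<le> d \<Longrightarrow> l < y \<and> y < h"
    using assms(1,2) by (auto simp: d_def min_def abs_if field_simps split: if_splits)
  have "compact ((\<lambda>p. f' (fst p) (snd p)) ` ({y0 - d..y0 + d} \<times> sphere 0 1))"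
    by (intro compact_continuous_image continuous_on_subset[OF cf'] compact_Times)
       (use d in \<open>force simp: abs_le_iff\<close>)+
  then obtain C where C: "\<And>y z. \<bar>y - y0\<bar> \<le> d \<Longrightarrow> z \<in> sphere 0 1 \<Longrightarrow> \<bar>f' y z\<bar> \<le> C"
    by (drule_tac compact_imp_bounded) (force simp: bounded_iff abs_le_iff)
  have c0: "continuous_on (sphere 0 1) (f' y0)"
  proof -
    have "continuous_on (sphere 0 1) ((\<lambda>p. f' (fst p) (snd p)) \<circ> (\<lambda>z. (y0, z)))"
      by (intro continuous_on_compose continuous_intros continuous_on_subset[OF cf'])
         (use assms in auto)
    then show ?thesis by (simp add: o_def)
  qed
  show ?thesis
    by (rule has_real_derivative_integral_bounded[where d = d and C = C])
       (use d C der cf c0 in \<open>auto simp: space_M intro!: integrable_continuous meas_continuous\<close>)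
qed

definition A :: "real \<Rightarrow> real \<Rightarrow> real" where
  "A a b = (\<integral>z. V b z powr a \<partial>M)"

definition B :: "real \<Rightarrow> real \<Rightarrow> real" where
  "B a b = (\<integral>z. V b z powr a * ln (V b z) \<partial>M)"

lemma cont_pos [continuous_intros]:
  assumes "\<bar>b\<bar> < 1"
  shows "continuous_on (sphere 0 1) (\<lambda>z. V b z powr a)" "continuous_on (sphere 0 1) (\<lambda>z. ln (V b z))"
  using V_pos[OF _ assms] by (auto intro!: continuous_intros dest: less_imp_neq[THEN not_sym] simp: less_imp_neq[THEN not_sym])

lemma integral_pos:
  fixes f :: "complex \<Rightarrow> real"
  assumes "continuous_on (sphere 0 1) f" and "\<And>z. z \<in> sphere 0 1 \<Longrightarrow> 0 < f z"
  shows "0 < (\<integral>z. f z \<partial>M)"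
proof -
  have "(1 :: complex) \<in> sphere 0 1" by simp
  then have "sphere 0 1 \<noteq> ({} :: complex set)" by blast
  then obtain z0 where z0: "z0 \<in> sphere 0 1" "\<And>z. z \<in> sphere 0 1 \<Longrightarrow> f z0 \<le> f z"
    using continuous_attains_inf[of "sphere 0 1" f] assms by auto
  have "(\<integral>z. f z0 \<partial>M) \<le> (\<integral>z. f z \<partial>M)"
    by (rule integral_mono) (use z0 assms(1) in \<open>auto simp: space_M intro!: integrable_continuous\<close>)
  then show ?thesis using assms(2)[OF z0(1)] by (simp add: prob_space)
qed

lemma A_pos: "\<bar>b\<bar> < 1 \<Longrightarrow> 0 < A a b"
  unfolding A_def by (intro integral_pos continuous_intros) (auto dest: V_pos)

lemma A_exponent_0: "\<bar>b\<bar> < 1 \<Longrightarrow> A 0 b = 1"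
proof -
  assume "\<bar>b\<bar> < 1"
  then have "A 0 b = (\<integral>z. 1 \<partial>M)"
    unfolding A_def by (intro Bochner_Integration.integral_cong) (auto simp: space_M dest: V_pos)
  then show ?thesis by (simp add: prob_space)
qed

text \<open>Symmetry is available only for powers of \<open>V\<close>. With exponent 1 and b = 1 it
  equates 2 - 2 I and 2 + 2 I, where I is the integral in question.\<close>

lemma integral_Re: "(\<integral>z. Re z \<partial>M) = 0"
proof -
  have *: "(\<integral>z. V b z powr 1 \<partial>M) = 1 + b\<^sup>2 + 2 * b * (\<integral>z. Re z \<partial>M)" for b
  proof -
    have "(\<integral>z. V b z powr 1 \<partial>M) = (\<integral>z. 1 + b\<^sup>2 + 2 * b * Re z \<partial>M)"
      by (intro Bochner_Integration.integral_cong) (auto simp: space_M V_nonneg powr_one V_def[symmetric])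
    also have "\<dots> = 1 + b\<^sup>2 + 2 * b * (\<integral>z. Re z \<partial>M)"
      by (simp add: integrable_continuous prob_space continuous_intros)
    finally show ?thesis .
  qed
  show ?thesis using reflect[of 1 1] *[of 1] *[of "-1"] by simp
qed

lemma A_1: "A 1 b = 1 + b\<^sup>2"
proof -
  have "A 1 b = (\<integral>z. 1 + b\<^sup>2 + 2 * b * Re z \<partial>M)"
    unfolding A_def by (intro Bochner_Integration.integral_cong) (auto simp: space_M V_nonneg powr_one V_def[symmetric])
  also have "\<dots> = 1 + b\<^sup>2"
    by (simp add: integrable_continuous prob_space continuous_intros integral_Re)
  finally show ?thesis .
qed

end

lemma DERIV_V [derivative_intros]: "((\<lambda>b. V b z) has_real_derivative (2 * b + 2 * Re z)) (at b)"
  unfolding V_def by (auto intro!: derivative_eq_intros)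

lemma V_powr_diff1: "0 < V b z \<Longrightarrow> V b z powr (a - 1) * V b z = V b z powr a"
  using powr_add[of "V b z" "a - 1" 1] by simp

text \<open>\<open>p0\<close>, \<open>p1\<close>, \<open>p2\<close> stand for V^a, V^(a-1), V^(a-2),
  and \<open>L\<close> for ln V. Once the powers are known only through \<open>p1 * v = p0\<close>
  and \<open>p2 * v = p1\<close>, every pointwise identity that is integrated below is
  polynomial.\<close>

lemma V_powr_identities:
  fixes b x v p0 p1 p2 \<mu> a L :: real
  assumes "p1 * v = p0"
  shows "v = b * (2 * b + 2 * x) + (1 - b\<^sup>2) \<Longrightarrow> b * (p1 * (2 * b + 2 * x)) = p0 - (1 - b\<^sup>2) * p1"
    and "v = b * (2 * b + 2 * x) + (1 - b\<^sup>2) \<Longrightarrow> b * ((a * L + 1) * p1 * (2 * b + 2 * x))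
      = a * (p0 * L) - a * (1 - b\<^sup>2) * (p1 * L) + (p0 - (1 - b\<^sup>2) * p1)"
    and "v = 2 * b * x + (1 + b\<^sup>2) \<Longrightarrow> 2 * b * (x * p1) = p0 - (1 + b\<^sup>2) * p1"
    and "p2 * v = p1 \<Longrightarrow> v = 2 * b * x + (1 + b\<^sup>2) \<Longrightarrow>
      4 * b\<^sup>2 * ((1 - x\<^sup>2) * p2) = (2 * (1 + b\<^sup>2)) * p1 - p0 - (1 - b\<^sup>2)\<^sup>2 * p2"
    and "p2 * v = p1 \<Longrightarrow> p2 * (v - \<mu>)\<^sup>2 = p0 - (2 * \<mu>) * p1 + \<mu>\<^sup>2 * p2"
proof -
  show "b * (p1 * (2 * b + 2 * x)) = p0 - (1 - b\<^sup>2) * p1" if "v = b * (2 * b + 2 * x) + (1 - b\<^sup>2)"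
    by (simp add: assms[symmetric] that power2_eq_square algebra_simps)
  show "b * ((a * L + 1) * p1 * (2 * b + 2 * x))
      = a * (p0 * L) - a * (1 - b\<^sup>2) * (p1 * L) + (p0 - (1 - b\<^sup>2) * p1)" if "v = b * (2 * b + 2 * x) + (1 - b\<^sup>2)"
    by (simp add: assms[symmetric] that power2_eq_square algebra_simps)
  show "2 * b * (x * p1) = p0 - (1 + b\<^sup>2) * p1" if "v = 2 * b * x + (1 + b\<^sup>2)"
    by (simp add: assms[symmetric] that power2_eq_square algebra_simps)
  show "4 * b\<^sup>2 * ((1 - x\<^sup>2) * p2) = (2 * (1 + b\<^sup>2)) * p1 - p0 - (1 - b\<^sup>2)\<^sup>2 * p2"
    if "p2 * v = p1" "v = 2 * b * x + (1 + b\<^sup>2)"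
    by (simp add: assms[symmetric] that(1)[symmetric] that(2) power2_eq_square algebra_simps)
  show "p2 * (v - \<mu>)\<^sup>2 = p0 - (2 * \<mu>) * p1 + \<mu>\<^sup>2 * p2" if "p2 * v = p1"
    by (simp add: assms[symmetric] that[symmetric] power2_eq_square algebra_simps)
qed

section \<open>Derivatives, recurrences and inequalities for the moments\<close>

context circle_measure
begin

text \<open>Exponent and parameter move together because norms are later compared along a curve s ->
  (s / 2, b(s)). A constant \<open>e\<close> or a constant \<open>g\<close> gives the partial
  derivatives.\<close>

lemma A_curve_deriv:
  assumes "l < y0" "y0 < h"
    and e: "\<And>y. l < y \<Longrightarrow> y < h \<Longrightarrow> (e has_real_derivative e' y) (at y)"
    and g: "\<And>y. l < y \<Longrightarrow> y < h \<Longrightarrow> (g has_real_derivative g' y) (at y)"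
    and g1: "\<And>y. l < y \<Longrightarrow> y < h \<Longrightarrow> \<bar>g y\<bar> < 1"
    and ce': "continuous_on {l<..<h} e'" and cg': "continuous_on {l<..<h} g'"
  shows "((\<lambda>y. A (e y) (g y)) has_real_derivative
    e' y0 * B (e y0) (g y0) + e y0 * g' y0 * (\<integral>z. V (g y0) z powr (e y0 - 1) * (2 * g y0 + 2 * Re z) \<partial>M)) (at y0)"
proof -
  let ?f' = "\<lambda>y z. e' y * (V (g y) z powr e y * ln (V (g y) z))
    + e y * g' y * (V (g y) z powr (e y - 1) * (2 * g y + 2 * Re z))"
  have ce: "continuous_on {l<..<h} e"
    using e by (intro continuous_at_imp_continuous_on) (force intro: DERIV_isCont)
  have cg: "continuous_on {l<..<h} g"
    using g by (intro continuous_at_imp_continuous_on) (force intro: DERIV_isCont)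
  have cfst: "continuous_on ({l<..<h} \<times> sphere 0 1) (\<lambda>p. k (fst p))"
    if "continuous_on {l<..<h} k" for k :: "real \<Rightarrow> real"
    by (rule continuous_on_compose2[OF that continuous_on_fst[OF continuous_on_id]]) auto
  have "((\<lambda>y. A (e y) (g y)) has_real_derivative (\<integral>z. ?f' y0 z \<partial>M)) (at y0)"
    unfolding A_def
  proof (rule has_real_derivative_integral_circle[OF assms(1,2)])
    fix y z assume y: "l < y" "y < h" and z: "z \<in> sphere (0::complex) 1"
    have p: "0 < V (g y) z" using V_pos g1 y z by auto
    have "((\<lambda>y. V (g y) z) has_real_derivative (2 * g y + 2 * Re z) * g' y) (at y)"
      by (rule DERIV_chain2[OF DERIV_V g]) fact+
    from DERIV_powr[OF this p e[OF y]] show "((\<lambda>y. V (g y) z powr e y) has_real_derivative ?f' y z) (at y)"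
      by (rule DERIV_cong) (use p in \<open>simp add: powr_diff field_simps\<close>)
  next
    fix y assume "l < y" "y < h"
    then show "continuous_on (sphere 0 1) (\<lambda>z. V (g y) z powr e y)"
      by (intro continuous_intros g1)
  next
    have "V (g y) z \<noteq> 0" if "l < y" "y < h" "cmod z = 1" for y z
      using V_pos g1 that by force
    then show "continuous_on ({l<..<h} \<times> sphere 0 1) (\<lambda>p. ?f' (fst p) (snd p))"
      by (intro continuous_intros cfst ce cg ce' cg') auto
  qed
  also have "(\<integral>z. ?f' y0 z \<partial>M) = e' y0 * B (e y0) (g y0) + e y0 * g' y0 * (\<integral>z. V (g y0) z powr (e y0 - 1) * (2 * g y0 + 2 * Re z) \<partial>M)"
    unfolding B_def using assms(1,2) g1
    by (subst Bochner_Integration.integral_add)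
       (auto intro!: integrable_continuous continuous_intros)
  finally show ?thesis .
qed

lemma A_deriv_b:
  assumes "\<bar>b\<bar> < 1"
  shows "(A a has_real_derivative a * (\<integral>z. V b z powr (a - 1) * (2 * b + 2 * Re z) \<partial>M)) (at b)"
proof -
  have "((\<lambda>y. A ((\<lambda>_. a) y) ((\<lambda>y. y) y)) has_real_derivative
     0 * B a b + a * 1 * (\<integral>z. V b z powr (a - 1) * (2 * b + 2 * Re z) \<partial>M)) (at b)"
    by (rule A_curve_deriv[where l = "-1" and h = 1]) (use assms in \<open>auto intro!: derivative_eq_intros\<close>)
  then show ?thesis by simp
qed

lemma A_deriv_a:
  assumes "\<bar>b\<bar> < 1"
  shows "((\<lambda>a. A a b) has_real_derivative B a b) (at a)"
proof -
  have "((\<lambda>y. A y ((\<lambda>_. b) y)) has_real_derivative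
     1 * B a b + a * 0 * (\<integral>z. V b z powr (a - 1) * (2 * b + 2 * Re z) \<partial>M)) (at a)"
    by (rule A_curve_deriv[where l = "a - 1" and h = "a + 1"]) (use assms in \<open>auto intro!: derivative_eq_intros\<close>)
  then show ?thesis by simp
qed

text \<open>Pointwise b dV/db = V - (1 - b^2), so differentiation in b stays within the family of
  moments and only brings in the exponent below.\<close>

lemma b_times_A_deriv:
  assumes "\<bar>b\<bar> < 1"
  shows "b * (\<integral>z. V b z powr (a - 1) * (2 * b + 2 * Re z) \<partial>M) = A a b - (1 - b\<^sup>2) * A (a - 1) b"
proof -
  have "b * (\<integral>z. V b z powr (a - 1) * (2 * b + 2 * Re z) \<partial>M)
    = (\<integral>z. V b z powr a - (1 - b\<^sup>2) * V b z powr (a - 1) \<partial>M)"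
    unfolding integral_mult_right_zero[symmetric]
  proof (rule Bochner_Integration.integral_cong[OF refl])
    fix z assume "z \<in> space M"
    then have "V b z powr (a - 1) * V b z = V b z powr a"
      using assms by (intro V_powr_diff1 V_pos) (auto simp: space_M)
    moreover have "V b z = b * (2 * b + 2 * Re z) + (1 - b\<^sup>2)"
      by (simp add: V_def power2_eq_square algebra_simps)
    ultimately show "b * (V b z powr (a - 1) * (2 * b + 2 * Re z)) = V b z powr a - (1 - b\<^sup>2) * V b z powr (a - 1)"
      by (rule V_powr_identities)
  qed
  also have "\<dots> = A a b - (1 - b\<^sup>2) * A (a - 1) b"
    unfolding A_def using assms by (simp add: integrable_continuous continuous_intros)
  finally show ?thesis .
qed

lemma A_deriv:
  assumes "0 < b" "b < 1"
  shows "(A a has_real_derivative a * (A a b - (1 - b\<^sup>2) * A (a - 1) b) / b) (at b)"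
proof -
  have b: "\<bar>b\<bar> < 1" using assms by simp
  have "a * (\<integral>z. V b z powr (a - 1) * (2 * b + 2 * Re z) \<partial>M) = a * (A a b - (1 - b\<^sup>2) * A (a - 1) b) / b"
    unfolding b_times_A_deriv[OF b, symmetric] using assms by simp
  then show ?thesis by (rule DERIV_cong[OF A_deriv_b[OF b]])
qed

lemma B_deriv_b:
  assumes "\<bar>b\<bar> < 1"
  shows "(B a has_real_derivative (\<integral>z. (a * ln (V b z) + 1) * V b z powr (a - 1) * (2 * b + 2 * Re z) \<partial>M)) (at b)"
  unfolding B_def
proof (rule has_real_derivative_integral_circle[where l = "-1" and h = 1])
  fix y :: real and z assume y: "-1 < y" "y < 1" and z: "z \<in> sphere (0::complex) 1"
  have p: "0 < V y z" using V_pos y z by auto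
  have "((\<lambda>y. ln (V y z)) has_real_derivative (2 * y + 2 * Re z) / V y z) (at y)"
    using p by (auto intro!: derivative_eq_intros simp: field_simps)
  moreover have "((\<lambda>y. V y z powr a) has_real_derivative a * V y z powr (a - 1) * (2 * y + 2 * Re z)) (at y)"
    using p by (auto intro!: derivative_eq_intros)
  ultimately have "((\<lambda>y. V y z powr a * ln (V y z)) has_real_derivative
    a * V y z powr (a - 1) * (2 * y + 2 * Re z) * ln (V y z) + (2 * y + 2 * Re z) / V y z * V y z powr a) (at y)"
    by (rule DERIV_mult[rotated])
  also have "a * V y z powr (a - 1) * (2 * y + 2 * Re z) * ln (V y z) + (2 * y + 2 * Re z) / V y z * V y z powr a
    = (a * ln (V y z) + 1) * V y z powr (a - 1) * (2 * y + 2 * Re z)"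
    using p by (simp add: powr_diff distrib_right distrib_left add_divide_distrib mult_ac)
  finally show "((\<lambda>y. V y z powr a * ln (V y z)) has_real_derivative (a * ln (V y z) + 1) * V y z powr (a - 1) * (2 * y + 2 * Re z)) (at y)" .
next
  have "V y z \<noteq> 0" if "-1 < y" "y < 1" "cmod z = 1" for y :: real and z
    using V_pos[of z y] that by force
  then show "continuous_on ({-1<..<1} \<times> sphere 0 1) (\<lambda>p :: real \<times> complex. (a * ln (V (fst p) (snd p)) + 1) * V (fst p) (snd p) powr (a - 1) * (2 * fst p + 2 * Re (snd p)))"
    by (intro continuous_intros) auto
qed (use assms in \<open>auto intro!: continuous_intros\<close>)

lemma B_deriv:
  assumes "0 < b" "b < 1"
  shows "(B a has_real_derivative (a * (B a b - (1 - b\<^sup>2) * B (a - 1) b) + A a b - (1 - b\<^sup>2) * A (a - 1) b) / b) (at b)"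
proof -
  have b: "\<bar>b\<bar> < 1" using assms by simp
  have "b * (\<integral>z. (a * ln (V b z) + 1) * V b z powr (a - 1) * (2 * b + 2 * Re z) \<partial>M)
    = (\<integral>z. a * (V b z powr a * ln (V b z)) - a * (1 - b\<^sup>2) * (V b z powr (a - 1) * ln (V b z))
          + (V b z powr a - (1 - b\<^sup>2) * V b z powr (a - 1)) \<partial>M)"
    unfolding integral_mult_right_zero[symmetric]
  proof (rule Bochner_Integration.integral_cong[OF refl])
    fix z assume "z \<in> space M"
    then have "V b z powr (a - 1) * V b z = V b z powr a"
      using b by (intro V_powr_diff1 V_pos) (auto simp: space_M)
    moreover have "V b z = b * (2 * b + 2 * Re z) + (1 - b\<^sup>2)"
      by (simp add: V_def power2_eq_square algebra_simps)
    ultimately show "b * ((a * ln (V b z) + 1) * V b z powr (a - 1) * (2 * b + 2 * Re z))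
      = a * (V b z powr a * ln (V b z)) - a * (1 - b\<^sup>2) * (V b z powr (a - 1) * ln (V b z))
          + (V b z powr a - (1 - b\<^sup>2) * V b z powr (a - 1))"
      by (rule V_powr_identities)
  qed
  also have "\<dots> = a * B a b - a * (1 - b\<^sup>2) * B (a - 1) b + (A a b - (1 - b\<^sup>2) * A (a - 1) b)"
    unfolding A_def B_def using b by (simp add: integrable_continuous continuous_intros)
  finally have "(\<integral>z. (a * ln (V b z) + 1) * V b z powr (a - 1) * (2 * b + 2 * Re z) \<partial>M)
    = (a * (B a b - (1 - b\<^sup>2) * B (a - 1) b) + A a b - (1 - b\<^sup>2) * A (a - 1) b) / b"
    using assms by (simp add: field_simps)
  then show ?thesis by (rule DERIV_cong[OF B_deriv_b[OF b]])
qed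

lemma A_deriv_0: "(A a has_real_derivative 0) (at 0)"
  using A_deriv_b[of 0 a] by (simp add: V_def integral_Re)

lemma B_deriv_0: "(B a has_real_derivative 0) (at 0)"
  using B_deriv_b[of 0 a] by (simp add: V_def integral_Re)

text \<open>Stein's identity at exponent a - 1, multiplied by 2b. With x = Re z, both integrands
  become combinations of powers of V through 2bx = V - (1 + b^2) and 4b^2 (1 - x^2) = 2 (1 + b^2) V
  - V^2 - (1 - b^2)^2.\<close>

lemma A_recurrence:
  assumes "0 \<le> b" "b < 1"
  shows "(m + a) * A a b - (m + 2 * a - 1) * (1 + b\<^sup>2) * A (a - 1) b + (a - 1) * (1 - b\<^sup>2)\<^sup>2 * A (a - 2) b = 0"
proof -
  have b: "\<bar>b\<bar> < 1" using assms by simp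
  have V1: "V b z powr (a - 1) * V b z = V b z powr a" "V b z powr (a - 2) * V b z = V b z powr (a - 1)"
    if "cmod z = 1" for z
    using V_powr_diff1[OF V_pos[OF that b], of a] V_powr_diff1[OF V_pos[OF that b], of "a - 1"] by simp_all
  have "2 * b * (\<integral>z. Re z * V b z powr (a - 1) \<partial>M) = (\<integral>z. V b z powr a - (1 + b\<^sup>2) * V b z powr (a - 1) \<partial>M)"
    unfolding integral_mult_right_zero[symmetric]
  proof (rule Bochner_Integration.integral_cong[OF refl])
    fix z assume "z \<in> space M"
    then have "V b z powr (a - 1) * V b z = V b z powr a"
      using V1 by (auto simp: space_M)
    moreover have "V b z = 2 * b * Re z + (1 + b\<^sup>2)" by (simp add: V_def)
    ultimately show "2 * b * (Re z * V b z powr (a - 1)) = V b z powr a - (1 + b\<^sup>2) * V b z powr (a - 1)"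
      by (rule V_powr_identities)
  qed
  also have "\<dots> = A a b - (1 + b\<^sup>2) * A (a - 1) b"
    unfolding A_def using b by (simp add: integrable_continuous continuous_intros)
  finally have 1: "2 * b * (\<integral>z. Re z * V b z powr (a - 1) \<partial>M) = A a b - (1 + b\<^sup>2) * A (a - 1) b" .
  have "4 * b\<^sup>2 * (\<integral>z. (1 - (Re z)\<^sup>2) * V b z powr (a - 2) \<partial>M)
    = (\<integral>z. (2 * (1 + b\<^sup>2)) * V b z powr (a - 1) - V b z powr a - (1 - b\<^sup>2)\<^sup>2 * V b z powr (a - 2) \<partial>M)"
    unfolding integral_mult_right_zero[symmetric]
  proof (rule Bochner_Integration.integral_cong[OF refl])
    fix z assume "z \<in> space M"
    then have "V b z powr (a - 1) * V b z = V b z powr a" "V b z powr (a - 2) * V b z = V b z powr (a - 1)"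
      using V1 by (auto simp: space_M)
    moreover have "V b z = 2 * b * Re z + (1 + b\<^sup>2)" by (simp add: V_def)
    ultimately show "4 * b\<^sup>2 * ((1 - (Re z)\<^sup>2) * V b z powr (a - 2))
      = (2 * (1 + b\<^sup>2)) * V b z powr (a - 1) - V b z powr a - (1 - b\<^sup>2)\<^sup>2 * V b z powr (a - 2)"
      by (rule V_powr_identities)
  qed
  also have "\<dots> = 2 * (1 + b\<^sup>2) * A (a - 1) b - A a b - (1 - b\<^sup>2)\<^sup>2 * A (a - 2) b"
    unfolding A_def using b by (simp add: integrable_continuous continuous_intros)
  finally have 2: "4 * b\<^sup>2 * (\<integral>z. (1 - (Re z)\<^sup>2) * V b z powr (a - 2) \<partial>M)
    = 2 * (1 + b\<^sup>2) * A (a - 1) b - A a b - (1 - b\<^sup>2)\<^sup>2 * A (a - 2) b" .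
  have "(m + 1) * (\<integral>z. Re z * V b z powr (a - 1) \<partial>M) = 2 * (a - 1) * b * (\<integral>z. (1 - (Re z)\<^sup>2) * V b z powr (a - 2) \<partial>M)"
    using stein[OF assms, of "a - 1"] by simp
  with 1 2 show ?thesis by algebra
qed

text \<open>The recurrence for \<open>A\<close> holds identically in the exponent, so it may be
  differentiated in \<open>a\<close>; \<open>B\<close> is the derivative of \<open>A\<close> in the
  exponent.\<close>

lemma B_recurrence:
  assumes "0 \<le> b" "b < 1"
  shows "A a b + (m + a) * B a b - 2 * (1 + b\<^sup>2) * A (a - 1) b - (m + 2 * a - 1) * (1 + b\<^sup>2) * B (a - 1) b
    + (1 - b\<^sup>2)\<^sup>2 * A (a - 2) b + (a - 1) * (1 - b\<^sup>2)\<^sup>2 * B (a - 2) b = 0"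
proof -
  have b: "\<bar>b\<bar> < 1" using assms by simp
  have sh: "((\<lambda>a. A (a - k) b) has_real_derivative B (a - k) b) (at a)" for k
    using DERIV_chain2[OF A_deriv_a[OF b] DERIV_diff[OF DERIV_ident DERIV_const], of k a] by simp
  let ?R = "\<lambda>a. (m + a) * A a b - (m + 2 * a - 1) * (1 + b\<^sup>2) * A (a - 1) b + (a - 1) * (1 - b\<^sup>2)\<^sup>2 * A (a - 2) b"
  have "(?R has_real_derivative A a b + (m + a) * B a b - 2 * (1 + b\<^sup>2) * A (a - 1) b - (m + 2 * a - 1) * (1 + b\<^sup>2) * B (a - 1) b
    + (1 - b\<^sup>2)\<^sup>2 * A (a - 2) b + (a - 1) * (1 - b\<^sup>2)\<^sup>2 * B (a - 2) b) (at a)"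
    by (rule derivative_eq_intros sh A_deriv_a[OF b] refl)+ (simp add: algebra_simps)
  moreover have "?R = (\<lambda>_. 0)" using A_recurrence[OF assms] by auto
  ultimately have "((\<lambda>_. 0) has_real_derivative A a b + (m + a) * B a b - 2 * (1 + b\<^sup>2) * A (a - 1) b - (m + 2 * a - 1) * (1 + b\<^sup>2) * B (a - 1) b
    + (1 - b\<^sup>2)\<^sup>2 * A (a - 2) b + (a - 1) * (1 - b\<^sup>2)\<^sup>2 * B (a - 2) b) (at a)"
    by simp
  then show ?thesis by (rule DERIV_unique[OF _ DERIV_const])
qed

lemma A_log_convex:
  assumes "\<bar>b\<bar> < 1"
  shows "(A (a - 1) b)\<^sup>2 \<le> A a b * A (a - 2) b"
proof -
  \<comment> \<open>The mean of V under the weight V^(a-2). This choice minimises the integral of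
    V^(a-2) (V - \<mu>)^2, so nonnegativity of the minimum is Cauchy-Schwarz.\<close>
  define \<mu> where "\<mu> = A (a - 1) b / A (a - 2) b"
  have "0 \<le> (\<integral>z. V b z powr (a - 2) * (V b z - \<mu>)\<^sup>2 \<partial>M)" by (rule Bochner_Integration.integral_nonneg) simp
  also have "\<dots> = (\<integral>z. V b z powr a - (2 * \<mu>) * V b z powr (a - 1) + \<mu>\<^sup>2 * V b z powr (a - 2) \<partial>M)"
  proof (rule Bochner_Integration.integral_cong[OF refl])
    fix z assume "z \<in> space M"
    then have "0 < V b z" using assms V_pos by (simp add: space_M)
    from V_powr_diff1[OF this, of a] V_powr_diff1[OF this, of "a - 1"]
    have "V b z powr (a - 1) * V b z = V b z powr a" "V b z powr (a - 2) * V b z = V b z powr (a - 1)"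
      by simp_all
    then show "V b z powr (a - 2) * (V b z - \<mu>)\<^sup>2 = V b z powr a - (2 * \<mu>) * V b z powr (a - 1) + \<mu>\<^sup>2 * V b z powr (a - 2)"
      by (rule V_powr_identities)
  qed
  also have "\<dots> = A a b - 2 * \<mu> * A (a - 1) b + \<mu>\<^sup>2 * A (a - 2) b"
    unfolding A_def using assms by (simp add: integrable_continuous continuous_intros)
  also have "\<dots> = A a b - (A (a - 1) b)\<^sup>2 / A (a - 2) b"
    unfolding \<mu>_def using A_pos[OF assms, of "a - 2"] by (simp add: field_simps power2_eq_square)
  finally show ?thesis using A_pos[OF assms, of "a - 2"] by (simp add: field_simps)
qed

text \<open>1 + b^2 is the mean of V. For a >= 1 the functions V^(a-1) and V are ordered alike, and
  the subtracted constant power contributes nothing because V - (1 + b^2) has integral 0.\<close>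

lemma A_Chebyshev:
  assumes "\<bar>b\<bar> < 1" "1 \<le> a"
  shows "(1 + b\<^sup>2) * A (a - 1) b \<le> A a b"
proof -
  let ?c = "1 + b\<^sup>2"
  have "0 \<le> (\<integral>z. (V b z powr (a - 1) - ?c powr (a - 1)) * (V b z - ?c) \<partial>M)"
  proof (rule Bochner_Integration.integral_nonneg)
    fix z assume "z \<in> space M"
    then have p: "0 < V b z" using assms V_pos by (simp add: space_M)
    have c: "0 < ?c" by (simp add: add_pos_nonneg)
    show "0 \<le> (V b z powr (a - 1) - ?c powr (a - 1)) * (V b z - ?c)"
    proof (cases "V b z \<le> ?c")
      case True
      with powr_mono2[of "a - 1" "V b z" ?c] p assms(2) show ?thesis by (intro mult_nonpos_nonpos) simp_all
    next
      case False
      with powr_mono2[of "a - 1" ?c "V b z"] c assms(2) show ?thesis by (intro mult_nonneg_nonneg) simp_all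
    qed
  qed
  also have "\<dots> = (\<integral>z. V b z powr a - ?c * V b z powr (a - 1) - ?c powr (a - 1) * (V b z powr 1) + ?c powr (a - 1) * ?c \<partial>M)"
  proof (rule Bochner_Integration.integral_cong[OF refl])
    fix z assume "z \<in> space M"
    then have p: "0 < V b z" using assms V_pos by (simp add: space_M)
    show "(V b z powr (a - 1) - ?c powr (a - 1)) * (V b z - ?c)
      = V b z powr a - ?c * V b z powr (a - 1) - ?c powr (a - 1) * (V b z powr 1) + ?c powr (a - 1) * ?c"
      using V_powr_diff1[OF p, of a] p by (simp add: algebra_simps)
  qed
  also have "\<dots> = A a b - ?c * A (a - 1) b - ?c powr (a - 1) * A 1 b + ?c powr (a - 1) * ?c"
    unfolding A_def using assms by (simp add: integrable_continuous continuous_intros prob_space)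
  finally show ?thesis by (simp add: A_1)
qed

lemma A_shift_bounds:
  assumes "0 \<le> b" "b < 1"
  shows "(1 - b)\<^sup>2 * A (a - 1) b \<le> A a b" "A a b \<le> (1 + b)\<^sup>2 * A (a - 1) b"
proof -
  have b: "\<bar>b\<bar> < 1" using assms by simp
  have *: "(1 - b)\<^sup>2 * V b z powr (a - 1) \<le> V b z powr a \<and> V b z powr a \<le> (1 + b)\<^sup>2 * V b z powr (a - 1)"
    if "cmod z = 1" for z
    using V_bounds[OF that, of b] assms
    unfolding V_powr_diff1[OF V_pos[OF that b], of a, symmetric]
    by (auto simp: mult.commute[of _ "V b z"] intro!: mult_right_mono)
  have "(\<integral>z. (1 - b)\<^sup>2 * V b z powr (a - 1) \<partial>M) \<le> A a b" "A a b \<le> (\<integral>z. (1 + b)\<^sup>2 * V b z powr (a - 1) \<partial>M)"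
    unfolding A_def using * b
    by (intro integral_mono integrable_continuous continuous_intros; simp add: space_M)+
  then show "(1 - b)\<^sup>2 * A (a - 1) b \<le> A a b" "A a b \<le> (1 + b)\<^sup>2 * A (a - 1) b"
    by (simp_all add: A_def)
qed

text \<open>Concavity of ln for the probability weight V^(a-1) / A_(a-1), obtained by integrating
  the tangent line of ln at the weighted mean of V.\<close>

lemma B_Jensen:
  assumes "\<bar>b\<bar> < 1"
  shows "B (a - 1) b \<le> A (a - 1) b * ln (A a b / A (a - 1) b)"
proof -
  define \<mu> where "\<mu> = A a b / A (a - 1) b"
  have \<mu>: "0 < \<mu>" using A_pos[OF assms] by (simp add: \<mu>_def)
  have "B (a - 1) b \<le> (\<integral>z. V b z powr a / \<mu> + (ln \<mu> - 1) * V b z powr (a - 1) \<partial>M)"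
    unfolding B_def
  proof (rule integral_mono)
    fix z assume "z \<in> space M"
    then have p: "0 < V b z" using assms V_pos by (simp add: space_M)
    have "ln (V b z) \<le> V b z / \<mu> + (ln \<mu> - 1)"
      using ln_le_minus_one[of "V b z / \<mu>"] p \<mu> by (simp add: ln_div)
    then have "V b z powr (a - 1) * ln (V b z) \<le> V b z powr (a - 1) * (V b z / \<mu> + (ln \<mu> - 1))"
      by (rule mult_left_mono) simp
    also have "\<dots> = V b z powr a / \<mu> + (ln \<mu> - 1) * V b z powr (a - 1)"
      using V_powr_diff1[OF p, of a] by (simp add: algebra_simps add_divide_distrib)
    finally show "V b z powr (a - 1) * ln (V b z) \<le> V b z powr a / \<mu> + (ln \<mu> - 1) * V b z powr (a - 1)" .
  qed (use assms \<mu> in \<open>auto intro!: integrable_continuous continuous_intros\<close>)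
  also have "\<dots> = A a b / \<mu> + (ln \<mu> - 1) * A (a - 1) b"
    unfolding A_def using assms by (simp add: integrable_continuous continuous_intros)
  also have "\<dots> = A (a - 1) b * ln \<mu>"
    using A_pos[OF assms, of a] A_pos[OF assms, of "a - 1"] by (simp add: \<mu>_def algebra_simps)
  finally show ?thesis by (simp add: \<mu>_def)
qed

end

subsection \<open>The Riccati equation for ratios of moments\<close>

text \<open>If f x < 0, take the last point y before x with f y >= f x / 2. Beyond y the function is
  negative, hence nondecreasing, so f x >= f y, a contradiction. Only a limit at 0 is assumed, since
  the lemma is applied to quotients with zero denominator there.\<close>

lemma nonneg_if_DERIV_nonneg_where_negative:
  fixes f f' :: "real \<Rightarrow> real"
  assumes der: "\<And>x. 0 < x \<Longrightarrow> x < h \<Longrightarrow> (f has_real_derivative f' x) (at x)"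
    and f': "\<And>x. 0 < x \<Longrightarrow> x < h \<Longrightarrow> f x < 0 \<Longrightarrow> 0 \<le> f' x"
    and lim: "(f \<longlongrightarrow> 0) (at_right 0)"
    and x: "0 < x" "x < h"
  shows "0 \<le> f x"
proof (rule ccontr)
  assume "\<not> 0 \<le> f x"
  then have neg: "f x < f x / 2" "f x / 2 < 0" by auto
  have "eventually (\<lambda>y. f x / 2 < f y) (at_right 0)"
    using order_tendstoD(1)[OF lim neg(2)] .
  then obtain e where e: "0 < e" "\<And>y. 0 < y \<Longrightarrow> y < e \<Longrightarrow> f x / 2 < f y"
    unfolding eventually_at_right_field by auto
  have "e \<le> x" using e(2)[of x] x neg by (cases "x < e") auto
  define x0 where "x0 = e / 2"
  have x0: "0 < x0" "x0 \<le> x" "f x / 2 \<le> f x0"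
    using e(1) e(2)[of x0] \<open>e \<le> x\<close> by (auto simp: x0_def)
  let ?S = "{x0..x} \<inter> f -` {f x / 2..}"
  have cont: "continuous_on {x0..x} f"
    using x0 x by (intro continuous_at_imp_continuous_on ballI DERIV_isCont[OF der]) auto
  have "compact ?S"
    using continuous_closed_preimage[OF cont closed_atLeastAtMost closed_atLeast[of "f x / 2"]]
    by (simp add: compact_eq_bounded_closed bounded_Int)
  moreover have "?S \<noteq> {}" using x0 by auto
  ultimately obtain y where y: "y \<in> ?S" "\<And>z. z \<in> ?S \<Longrightarrow> z \<le> y"
    using compact_attains_sup[of ?S] by blast
  have "y < x" using y(1) neg by (cases "y = x") auto
  obtain z where z: "y < z" "z < x" "f x - f y = (x - y) * f' z"
    using MVT2[OF \<open>y < x\<close>, of f f'] der y(1) x0 x by auto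
  have "f z < 0" using y(2)[of z] y(1) z neg by force
  then have "0 \<le> f' z" using f'[of z] z y(1) x0 x by auto
  then have "f y \<le> f x" using z \<open>y < x\<close> by (smt (verit) mult_nonneg_nonneg)
  then show False using y(1) neg by auto
qed

text \<open>With b = tanh w this is cosh (2w). It is also the mean of V / (1 - b^2).\<close>

definition cosh_ratio :: "real \<Rightarrow> real" where
  "cosh_ratio b = (1 + b\<^sup>2) / (1 - b\<^sup>2)"

lemma cosh_ratio:
  assumes "0 < b" "b < 1"
  shows "1 < cosh_ratio b" "cosh_ratio b - 1 = 2 * b\<^sup>2 / (1 - b\<^sup>2)"
    "(cosh_ratio has_real_derivative ((cosh_ratio b)\<^sup>2 - 1) / b) (at b)"
proof -
  have b: "0 < 1 - b\<^sup>2" "0 < b\<^sup>2" using assms by (auto simp: power_less_one_iff)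
  show 1: "cosh_ratio b - 1 = 2 * b\<^sup>2 / (1 - b\<^sup>2)"
    using b unfolding cosh_ratio_def by (simp add: field_simps)
  have "0 < 2 * b\<^sup>2 / (1 - b\<^sup>2)" using b by simp
  with 1 show "1 < cosh_ratio b" by linarith
  have "(cosh_ratio has_real_derivative ((2 * b) * (1 - b\<^sup>2) - (1 + b\<^sup>2) * (- 2 * b)) / (1 - b\<^sup>2)\<^sup>2) (at b)"
    unfolding cosh_ratio_def using b
    by (auto intro!: derivative_eq_intros simp: power2_eq_square)
  also have "((2 * b) * (1 - b\<^sup>2) - (1 + b\<^sup>2) * (- 2 * b)) / (1 - b\<^sup>2)\<^sup>2 = ((cosh_ratio b)\<^sup>2 - 1) / b"
  proof -
    have "(cosh_ratio b)\<^sup>2 - 1 = ((1 + b\<^sup>2)\<^sup>2 - (1 - b\<^sup>2)\<^sup>2) / (1 - b\<^sup>2)\<^sup>2"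
      using b by (simp add: cosh_ratio_def power_divide diff_divide_distrib)
    also have "(1 + b\<^sup>2)\<^sup>2 - (1 - b\<^sup>2)\<^sup>2 = b * (4 * b)"
      by (simp add: power2_eq_square algebra_simps)
    moreover have "(2 * b) * (1 - b\<^sup>2) - (1 + b\<^sup>2) * (- 2 * b) = 4 * b"
      by (simp add: algebra_simps)
    ultimately show ?thesis using assms by simp
  qed
  finally show "(cosh_ratio has_real_derivative ((cosh_ratio b)\<^sup>2 - 1) / b) (at b)" .
qed

section \<open>Ratios of consecutive moments: Riccati equation, a priori bounds, expansion at
  0\<close>

context circle_measure
begin

text \<open>For U = V / (1 - b^2) this is the mean of U under the weight U^(a-1). Dividing by 1 -
  b^2 makes the range of U invariant under inversion.\<close>

definition A_ratio :: "real \<Rightarrow> real \<Rightarrow> real" where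
  "A_ratio a b = A a b / ((1 - b\<^sup>2) * A (a - 1) b)"

lemma A_ratio_pos:
  assumes "\<bar>b\<bar> < 1" shows "0 < A_ratio a b"
proof -
  have "b\<^sup>2 < 1" using assms by (simp add: abs_square_less_1)
  then show ?thesis using A_pos[OF assms] by (simp add: A_ratio_def)
qed

lemma A_ratio_recurrence:
  assumes "0 < b" "b < 1"
  shows "(m + a) * A_ratio a b + (a - 1) / A_ratio (a - 1) b = (m + 2 * a - 1) * cosh_ratio b"
proof -
  have b: "\<bar>b\<bar> < 1" "0 < 1 - b\<^sup>2" using assms by (auto simp: power_less_one_iff)
  have "0 = ((m + a) * A a b - (m + 2 * a - 1) * (1 + b\<^sup>2) * A (a - 1) b + (a - 1) * (1 - b\<^sup>2)\<^sup>2 * A (a - 2) b)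
      / ((1 - b\<^sup>2) * A (a - 1) b)"
    using A_recurrence[of b a] assms by simp
  also have "\<dots> = (m + a) * A_ratio a b - (m + 2 * a - 1) * cosh_ratio b + (a - 1) * (1 / A_ratio (a - 1) b)"
    using b(2) A_pos[OF b(1), of "a - 1"] A_pos[OF b(1), of "a - 2"]
    unfolding add_divide_distrib diff_divide_distrib
    by (simp add: A_ratio_def cosh_ratio_def power2_eq_square)
  finally show ?thesis by simp
qed

lemma ln_A_deriv:
  assumes "0 < b" "b < 1"
  shows "((\<lambda>b. ln (A a b)) has_real_derivative a * (1 - 1 / A_ratio a b) / b) (at b)"
proof -
  have b: "\<bar>b\<bar> < 1" using assms by simp
  have "((\<lambda>b. ln (A a b)) has_real_derivative a * (A a b - (1 - b\<^sup>2) * A (a - 1) b) / b / A a b) (at b)"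
    using DERIV_chain2[OF DERIV_ln[OF A_pos[OF b]] A_deriv[OF assms]] by (simp add: divide_inverse mult_ac)
  also have "a * (A a b - (1 - b\<^sup>2) * A (a - 1) b) / b / A a b = a * (1 - 1 / A_ratio a b) / b"
    using A_pos[OF b, of a] by (simp add: A_ratio_def diff_divide_distrib right_diff_distrib)
  finally show ?thesis .
qed

text \<open>The logarithmic derivative of the ratio involves the ratios at a and at a - 1. The
  recurrence expresses the second through the first, so the equation closes and is quadratic in
  \<open>t\<close>.\<close>

lemma A_ratio_deriv:
  fixes a b :: real
  assumes "0 < b" "b < 1"
  defines "t \<equiv> A_ratio a b" and "K \<equiv> cosh_ratio b"
  shows "(A_ratio a has_real_derivative ((m + 2 * a) * K * t - (m + a) * t\<^sup>2 - a) / b) (at b)"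
proof -
  have b: "\<bar>b\<bar> < 1" "0 < 1 - b\<^sup>2" using assms by (auto simp: power_less_one_iff)
  let ?s = "A_ratio (a - 1) b"
  have t: "0 < t" "0 < ?s" using A_ratio_pos[OF b(1)] by (auto simp: t_def)
  let ?L = "\<lambda>b. ln (A a b) - ln (A (a - 1) b) - ln (1 - b\<^sup>2)"
  have dl: "((\<lambda>b. ln (1 - b\<^sup>2)) has_real_derivative - (K - 1) / b) (at b)"
  proof -
    have "((\<lambda>b. ln (1 - b\<^sup>2)) has_real_derivative - 2 * b / (1 - b\<^sup>2)) (at b)"
      using b by (auto intro!: derivative_eq_intros)
    also have "- 2 * b / (1 - b\<^sup>2) = - (K - 1) / b"
      using assms(1) unfolding K_def cosh_ratio(2)[OF assms(1,2)] by (simp add: power2_eq_square)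
    finally show ?thesis .
  qed
  have "(?L has_real_derivative a * (1 - 1 / t) / b - (a - 1) * (1 - 1 / ?s) / b - - (K - 1) / b) (at b)"
    unfolding t_def by (intro DERIV_diff ln_A_deriv[OF assms(1,2)] dl)
  from DERIV_chain2[OF DERIV_exp this]
  have 1: "((\<lambda>b. exp (?L b)) has_real_derivative exp (?L b) * (a * (1 - 1 / t) / b - (a - 1) * (1 - 1 / ?s) / b - - (K - 1) / b)) (at b)" .
  have eq: "exp (?L y) = A_ratio a y" if "0 < y" "y < 1" for y
    using that A_pos[of y a] A_pos[of y "a - 1"] by (auto simp: exp_diff A_ratio_def power_less_one_iff mult.commute)
  have "(A_ratio a has_real_derivative exp (?L b) * (a * (1 - 1 / t) / b - (a - 1) * (1 - 1 / ?s) / b - - (K - 1) / b)) (at b)"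
    by (rule has_field_derivative_transform_within_open[OF 1, of "{0<..<1}"]) (use assms eq in auto)
  also have "exp (?L b) * (a * (1 - 1 / t) / b - (a - 1) * (1 - 1 / ?s) / b - - (K - 1) / b)
     = (t * (a * (1 - 1 / t) - (a - 1) + (a - 1) / ?s + (K - 1))) / b"
    using eq[OF assms(1,2)] by (simp add: t_def diff_divide_distrib add_divide_distrib algebra_simps)
  also have "(a - 1) / ?s = (m + 2 * a - 1) * K - (m + a) * t"
    using A_ratio_recurrence[OF assms(1,2), of a] by (simp add: t_def K_def)
  also have "t * (a * (1 - 1 / t) - (a - 1) + ((m + 2 * a - 1) * K - (m + a) * t) + (K - 1))
      = (m + 2 * a) * K * t - (m + a) * t\<^sup>2 - a"
    using t by (simp add: power2_eq_square algebra_simps)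
  finally show ?thesis .
qed

lemma cosh_ratio_le_A_ratio:
  assumes "0 < b" "b < 1" "1 \<le> a"
  shows "cosh_ratio b \<le> A_ratio a b"
proof -
  have b: "\<bar>b\<bar> < 1" "0 < 1 - b\<^sup>2" using assms by (auto simp: power_less_one_iff)
  show ?thesis
    using A_Chebyshev[OF b(1) assms(3)] A_pos[OF b(1), of "a - 1"] b(2)
    by (simp add: A_ratio_def cosh_ratio_def divide_simps mult.commute)
qed

lemma A_ratio_mono:
  assumes "0 < b" "b < 1"
  shows "A_ratio (a - 1) b \<le> A_ratio a b"
proof -
  have b: "\<bar>b\<bar> < 1" "0 < 1 - b\<^sup>2" using assms by (auto simp: power_less_one_iff)
  have "A (a - 1) b / A (a - 2) b \<le> A a b / A (a - 1) b"
    using A_log_convex[OF b(1), of a] A_pos[OF b(1), of "a - 1"] A_pos[OF b(1), of "a - 2"]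
    by (simp add: divide_simps power2_eq_square)
  from divide_right_mono[OF this, of "1 - b\<^sup>2"] b(2) show ?thesis
    by (simp add: A_ratio_def mult.commute)
qed

text \<open>The pointwise bounds on V put the ratio between y = (1 - b) / (1 + b) and 1/y. Since y +
  1/y = 2K, the claim is (t - y) (1/y - t) >= 0 multiplied out.\<close>

lemma A_ratio_quadratic:
  assumes "0 < b" "b < 1"
  shows "1 + (A_ratio a b)\<^sup>2 \<le> 2 * cosh_ratio b * A_ratio a b"
proof -
  have b: "\<bar>b\<bar> < 1" "0 < 1 - b\<^sup>2" using assms by (auto simp: power_less_one_iff)
  define t where "t = A_ratio a b"
  define y where "y = (1 - b) / (1 + b)"
  have y: "0 < y" "1 / y = (1 + b) / (1 - b)" using assms by (auto simp: y_def)
  have f: "1 - b\<^sup>2 = (1 - b) * (1 + b)" by (simp add: power2_eq_square algebra_simps)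
  have "y \<le> t" "t \<le> 1 / y"
    using A_shift_bounds[of b a] A_pos[OF b(1), of "a - 1"] assms
    unfolding y y_def t_def A_ratio_def f by (simp_all add: divide_simps power2_eq_square mult_ac)
  then have "0 \<le> (t - y) * (1 / y - t)" by simp
  moreover have "y + 1 / y = 2 * cosh_ratio b"
    using assms unfolding y(2) unfolding y_def cosh_ratio_def f
    by (simp add: add_frac_eq power2_eq_square algebra_simps)
  moreover have "(t - y) * (1 / y - t) = (y + 1 / y) * t - 1 - t\<^sup>2"
    using y(1) by (simp add: power2_eq_square field_simps)
  ultimately show ?thesis by (simp add: t_def)
qed

lemma integral_Re_sq: "(m + 2) * (\<integral>z. (Re z)\<^sup>2 \<partial>M) = 1"
proof -
  \<comment> \<open>Any value in (0, 1) would serve: at a = 2 the recurrence links the second moment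
    of Re z with the known \<open>A 1\<close> and \<open>A 0\<close>, and b cancels.\<close>
  let ?b = "1 / 2 :: real"
  have "A 2 ?b = (\<integral>z. 25 / 16 + 5 / 2 * Re z + (Re z)\<^sup>2 \<partial>M)"
    unfolding A_def
    by (intro Bochner_Integration.integral_cong refl)
       (simp add: V_nonneg space_M, simp add: V_def power2_eq_square algebra_simps)
  also have "\<dots> = 25 / 16 + (\<integral>z. (Re z)\<^sup>2 \<partial>M)"
    by (simp add: integrable_continuous continuous_intros prob_space integral_Re)
  finally show ?thesis
    using A_recurrence[of ?b 2] A_exponent_0[of ?b] A_1[of ?b] by (simp add: power2_eq_square field_simps)
qed

lemma A_tendsto_0: "(A a \<longlongrightarrow> 1) (at_right 0)"
proof -
  have "isCont (A a) 0" using DERIV_isCont[OF A_deriv_0] .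
  moreover have "A a 0 = 1" by (simp add: A_def V_def prob_space)
  ultimately show ?thesis
    by (metis isCont_def filterlim_at_split)
qed

text \<open>The quotient equals H b / (b A_a), where a H is the derivative of A_a. As H 0 = 0 and
  A_a tends to 1, the limit is H' 0 = 4 (a - 1) / (m + 2) + 2. It supplies the starting values of
  the barriers and the second-order term for necessity.\<close>

lemma A_ratio_expansion:
  "((\<lambda>b. (1 - 1 / A_ratio a b) / b\<^sup>2) \<longlongrightarrow> 2 * (m + 2 * a) / (m + 2)) (at_right 0)"
proof -
  define H where "H b = (\<integral>z. V b z powr (a - 1) * (2 * b + 2 * Re z) \<partial>M)" for b
  let ?f' = "\<lambda>b z. (a - 1) * V b z powr (a - 2) * (2 * b + 2 * Re z) * (2 * b + 2 * Re z) + 2 * V b z powr (a - 1)"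
  have "(H has_real_derivative (\<integral>z. ?f' 0 z \<partial>M)) (at 0)"
    unfolding H_def
  proof (rule has_real_derivative_integral_circle[where l = "-1" and h = 1])
    fix y :: real and z assume y: "-1 < y" "y < 1" and z: "z \<in> sphere (0::complex) 1"
    have p: "0 < V y z" using V_pos y z by auto
    show "((\<lambda>y. V y z powr (a - 1) * (2 * y + 2 * Re z)) has_real_derivative ?f' y z) (at y)"
      using p by (auto intro!: derivative_eq_intros simp: mult_ac)
  next
    have "V y z \<noteq> 0" if "-1 < y" "y < 1" "cmod z = 1" for y :: real and z
      using V_pos[of z y] that by force
    then show "continuous_on ({-1<..<1} \<times> sphere 0 1) (\<lambda>p. ?f' (fst p) (snd p))"
      by (intro continuous_intros) auto
  qed (auto intro!: continuous_intros)
  also have "(\<integral>z. ?f' 0 z \<partial>M) = 4 * (a - 1) * (\<integral>z. (Re z)\<^sup>2 \<partial>M) + 2"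
    by (simp add: V_def power2_eq_square integrable_continuous continuous_intros prob_space)
  also have "\<dots> = 2 * (m + 2 * a) / (m + 2)"
    using integral_Re_sq m_ge by (simp add: field_simps)
  finally have "((\<lambda>b. H b / b) \<longlongrightarrow> 2 * (m + 2 * a) / (m + 2)) (at 0)"
    unfolding has_field_derivative_iff by (simp add: H_def V_def integral_Re)
  then have 1: "((\<lambda>b. H b / b) \<longlongrightarrow> 2 * (m + 2 * a) / (m + 2)) (at_right 0)"
    by (rule filterlim_mono) (auto intro: at_le)
  have "((\<lambda>b. H b / b / A a b) \<longlongrightarrow> 2 * (m + 2 * a) / (m + 2) / 1) (at_right 0)"
    by (intro tendsto_divide 1 A_tendsto_0) simp
  moreover have "eventually (\<lambda>b. H b / b / A a b = (1 - 1 / A_ratio a b) / b\<^sup>2) (at_right 0)"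
    unfolding eventually_at_right_field
  proof (intro exI[of _ 1] conjI allI impI)
    fix b :: real assume b: "0 < b" "b < 1"
    then have "b * H b = A a b - (1 - b\<^sup>2) * A (a - 1) b"
      unfolding H_def by (intro b_times_A_deriv) simp
    then have "(1 - 1 / A_ratio a b) = b * H b / A a b"
      using A_pos[of b a] b by (simp add: A_ratio_def diff_divide_distrib)
    then show "H b / b / A a b = (1 - 1 / A_ratio a b) / b\<^sup>2"
      using b by (simp add: power2_eq_square)
  qed simp
  ultimately have "((\<lambda>b. (1 - 1 / A_ratio a b) / b\<^sup>2) \<longlongrightarrow> 2 * (m + 2 * a) / (m + 2) / 1) (at_right 0)"
    by (rule Lim_transform_eventually)
  then show ?thesis by simp
qed

end

text \<open>This polynomial is the numerator of the derivative in
  \<open>laplacian_bound_derivative\<close>. In the factor of \<open>u\<close>, the part -k (a - 1)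
  t K is split off; by the barrier u K <= t - K it is absorbed by k (a - 1) t (t - K). The rest of
  that factor is nonnegative by expansion, the last product by the range of
  \<open>t\<close>.\<close>

lemma barrier_polynomial_nonneg:
  fixes t K c d a k u :: real
  assumes a: "2 \<le> a" and c: "3 \<le> c" and d: "d = c - a" "0 \<le> d" and k: "k = K - 1" "0 < k"
    and tK: "K \<le> t" and quad: "1 + t\<^sup>2 \<le> 2 * K * t"
    and u: "0 \<le> u" "u * K \<le> t - K"
  shows "0 \<le> u * (k * (d * t\<^sup>2 - (c + K) * t) + t\<^sup>2 - 1) + k * (a - 1) * t * (t - K) + (t - 1) * (2 * K * t - 1 - t\<^sup>2)"
proof -
  define x where "x = t - K"
  have x: "0 \<le> x" "t = 1 + k + x" "K = 1 + k" using tK k(1) by (simp_all add: x_def)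
  \<comment> \<open>Expanding around t = K = 1 with K = 1 + k and t = 1 + k + x leaves only
    nonnegative coefficients, because c >= 3 and d >= 0.\<close>
  have "k * t * (d * t - c + (a - 2) * K) + t\<^sup>2 - 1
    = k * (k * (c - 3) + k\<^sup>2 * (c - 2)) + x * (k\<^sup>2 * (c - 2) + k * (1 + k) * d + 2) + x\<^sup>2 * (1 + k * d)"
    unfolding x(2,3) d(1) by (simp only: power2_eq_square) (simp add: algebra_simps)
  also have "\<dots> \<ge> 0"
    using k c d x by (intro mult_nonneg_nonneg add_nonneg_nonneg) auto
  finally have "0 \<le> u * (k * t * (d * t - c + (a - 2) * K) + t\<^sup>2 - 1)"
    using u by simp
  moreover have "k * (a - 1) * t * (u * K) \<le> k * (a - 1) * t * (t - K)"
    by (rule mult_left_mono[OF u(2)]) (use a k(2) x in simp)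
  moreover have "0 \<le> (t - 1) * (2 * K * t - 1 - t\<^sup>2)"
    by (rule mult_nonneg_nonneg) (use quad tK k in linarith)+
  moreover have "u * (k * (d * t\<^sup>2 - (c + K) * t) + t\<^sup>2 - 1)
     = u * (k * t * (d * t - c + (a - 2) * K) + t\<^sup>2 - 1) - k * (a - 1) * t * (u * K)"
    by (simp add: power2_eq_square algebra_simps)
  ultimately show ?thesis by linarith
qed

text \<open>\<open>N\<close> is b t' by the Riccati equation and the left side is b v'. The first
  summand on the right is nonnegative for a >= 2 and 1 <= K <= t, since x + 1/x increases on x >= 1;
  what remains is a multiple of \<open>v\<close>, whose sign is assumed in the barrier
  argument.\<close>

lemma Riccati_barrier_identity:
  fixes t K a c d :: real
  assumes "t \<noteq> 0" "K \<noteq> 0" and c: "c = d + a"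
  defines "N \<equiv> c * K * t - d * t\<^sup>2 - a" and "v \<equiv> d * t\<^sup>2 - ((c - 1) * K - 1 / K) * t + (a - 2)"
  shows "2 * d * t * N - ((c - 1) * (K\<^sup>2 - 1) + (K\<^sup>2 - 1) / K\<^sup>2) * t - ((c - 1) * K - 1 / K) * N
    = 2 * (a - 2) * (t + 1 / t - K - 1 / K) + (2 * K + 1 / K - 2 / t - 2 * d * t + (c - 1) * K) * v"
proof -
  define I J where "I = 1 / K" and "J = 1 / t"
  have IJ: "K * I = 1" "t * J = 1" using assms(1,2) by (auto simp: I_def J_def)
  have K2: "(K\<^sup>2 - 1) / K\<^sup>2 = 1 - I\<^sup>2"
    using assms(2) by (simp add: I_def diff_divide_distrib power_divide)
  have J2: "2 / t = 2 * J" by (simp add: J_def)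
  show ?thesis
    unfolding N_def v_def c K2 J2 I_def[symmetric] J_def[symmetric] using IJ by algebra
qed

text \<open>The left side is b times the derivative of the function in
  \<open>laplacian_bound_nonneg\<close>: \<open>N\<close> is b t', and \<open>u / t\<close> is b
  times the derivative of its logarithmic part.\<close>

lemma laplacian_bound_derivative:
  fixes t K a c d k :: real
  assumes "0 < t" "0 < k" and c: "c = d + a" and k: "k = K - 1"
  defines "N \<equiv> c * K * t - d * t\<^sup>2 - a" and "u \<equiv> (c - 1) * K * t - d * t\<^sup>2 - (a - 1)"
  shows "d * N - (c - 1) * (K\<^sup>2 - 1) + ((1 - 1 / t\<^sup>2) * N / k - (t - 1)\<^sup>2 * (K + 1) / (t * k)) - c * (u / t)
    = (u * (k * (d * t\<^sup>2 - (c + K) * t) + t\<^sup>2 - 1) + k * (a - 1) * t * (t - K) + (t - 1) * (2 * K * t - 1 - t\<^sup>2)) / (t\<^sup>2 * k)"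
proof -
  have K: "K = 1 + k" using k by simp
  define I J where "I = 1 / k" and "J = 1 / t"
  have IJ: "k * I = 1" "t * J = 1" using assms(1,2) by (auto simp: I_def J_def)
  have "d * N - (c - 1) * (K\<^sup>2 - 1) + ((1 - J\<^sup>2) * N * I - (t - 1)\<^sup>2 * (K + 1) * (J * I)) - c * (u * J)
    = (u * (k * (d * t\<^sup>2 - (c + K) * t) + t\<^sup>2 - 1) + k * (a - 1) * t * (t - K) + (t - 1) * (2 * K * t - 1 - t\<^sup>2)) * (J\<^sup>2 * I)"
    unfolding N_def u_def c K using IJ by algebra
  then show ?thesis by (simp add: I_def J_def power_one_over)
qed

section \<open>The barrier and the sign of the Laplacian after Jensen's inequality\<close>

context circle_measure
begin

lemma A_ratio_tendsto_1: "(A_ratio a \<longlongrightarrow> 1) (at_right 0)"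
proof -
  have "((\<lambda>b. A a b / ((1 - b\<^sup>2) * A (a - 1) b)) \<longlongrightarrow> 1 / ((1 - 0\<^sup>2) * 1)) (at_right 0)"
    by (intro tendsto_intros A_tendsto_0) simp
  then show ?thesis by (simp add: A_ratio_def[abs_def])
qed

lemma cosh_ratio_tendsto_1: "(cosh_ratio \<longlongrightarrow> 1) (at_right 0)"
proof -
  have "((\<lambda>b. (1 + b\<^sup>2) / (1 - b\<^sup>2)) \<longlongrightarrow> (1 + 0\<^sup>2) / (1 - 0\<^sup>2)) (at_right (0::real))"
    by (intro tendsto_intros) simp
  then show ?thesis by (simp add: cosh_ratio_def[abs_def])
qed

text \<open>
  By the recurrence, the claim is $(a-1)/t_{a-1} \le 1/K + (a-2)/t_a$ for $t_a = A_a/((1-b^2)A_{a-1})$.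
  Dividing by $K - 1$ makes the derivative nonnegative wherever the expression is negative.
\<close>

lemma Riccati_barrier_nonneg:
  assumes b: "0 < b" "b < 1" and a: "2 \<le> a"
  shows "0 \<le> (m + a) * (A_ratio a b)\<^sup>2 - ((m + 2 * a - 1) * cosh_ratio b - 1 / cosh_ratio b) * A_ratio a b + (a - 2)"
proof -
  define t where "t = A_ratio a"
  define K where "K = cosh_ratio"
  define c d where "c = m + 2 * a" and "d = m + a"
  define v where "v b = d * (t b)\<^sup>2 - ((c - 1) * K b - 1 / K b) * t b + (a - 2)" for b
  define C where "C b = 2 * K b + 1 / K b - 2 / t b - 2 * d * t b + (c - 1) * K b" for b
  have K: "1 < K b" "(K has_real_derivative ((K b)\<^sup>2 - 1) / b) (at b)" "K b - 1 = 2 * b\<^sup>2 / (1 - b\<^sup>2)" if "0 < b" "b < 1" for b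
    using cosh_ratio[OF that] by (simp_all add: K_def)
  have tK: "K b \<le> t b" if "0 < b" "b < 1" for b
    using cosh_ratio_le_A_ratio[OF that] a by (simp add: K_def t_def)
  have rec: "d * t b + (a - 1) / A_ratio (a - 1) b = (c - 1) * K b" if "0 < b" "b < 1" for b
    using A_ratio_recurrence[OF that, of a] by (simp add: c_def d_def t_def K_def)
  have "0 \<le> v b / (K b - 1)"
  proof (rule nonneg_if_DERIV_nonneg_where_negative[where f = "\<lambda>b. v b / (K b - 1)" and h = 1 and
      f' = "\<lambda>b. (2 * (a - 2) * (t b + 1 / t b - K b - 1 / K b) + (C b - K b - 1) * v b) / ((K b - 1) * b)"])
    fix b :: real assume b: "0 < b" "b < 1"
    note Kb = K[OF b]
    have tb: "1 < t b" using tK[OF b] Kb by simp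
    let ?N = "c * K b * t b - d * (t b)\<^sup>2 - a"
    have t': "(t has_real_derivative ?N / b) (at b)"
      using A_ratio_deriv[OF b, of a] by (simp add: t_def K_def c_def d_def)
    have "(v has_real_derivative (2 * d * t b * ?N - ((c - 1) * ((K b)\<^sup>2 - 1) + ((K b)\<^sup>2 - 1) / (K b)\<^sup>2) * t b
        - ((c - 1) * K b - 1 / K b) * ?N) / b) (at b)"
      unfolding v_def using Kb(1) b
      by (auto intro!: derivative_eq_intros t' Kb(2) simp: power2_eq_square field_simps)
    also have "2 * d * t b * ?N - ((c - 1) * ((K b)\<^sup>2 - 1) + ((K b)\<^sup>2 - 1) / (K b)\<^sup>2) * t b
        - ((c - 1) * K b - 1 / K b) * ?N = 2 * (a - 2) * (t b + 1 / t b - K b - 1 / K b) + C b * v b"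
      unfolding C_def v_def
      by (rule Riccati_barrier_identity) (use tb Kb in \<open>auto simp: c_def d_def\<close>)
    finally have v': "(v has_real_derivative (2 * (a - 2) * (t b + 1 / t b - K b - 1 / K b) + C b * v b) / b) (at b)" .
    have "((\<lambda>b. v b / (K b - 1)) has_real_derivative
        ((2 * (a - 2) * (t b + 1 / t b - K b - 1 / K b) + C b * v b) / b * (K b - 1) - v b * (((K b)\<^sup>2 - 1) / b)) / ((K b - 1) * (K b - 1))) (at b)"
      using Kb(1) by (auto intro!: derivative_eq_intros v' Kb(2))
    also have "((2 * (a - 2) * (t b + 1 / t b - K b - 1 / K b) + C b * v b) / b * (K b - 1) - v b * (((K b)\<^sup>2 - 1) / b)) / ((K b - 1) * (K b - 1))
      = (2 * (a - 2) * (t b + 1 / t b - K b - 1 / K b) + (C b - K b - 1) * v b) / ((K b - 1) * b)"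
    proof -
      have "(K b)\<^sup>2 - 1 = (K b - 1) * (K b + 1)" by (simp add: power2_eq_square algebra_simps)
      then have "(X / b * (K b - 1) - v b * (((K b)\<^sup>2 - 1) / b)) / ((K b - 1) * (K b - 1)) = (X - v b * (K b + 1)) / ((K b - 1) * b)" for X
        using Kb(1) b by (simp add: divide_simps) (simp add: algebra_simps)
      then show ?thesis by (simp only:) (simp add: algebra_simps)
    qed
    finally show "((\<lambda>b. v b / (K b - 1)) has_real_derivative
      (2 * (a - 2) * (t b + 1 / t b - K b - 1 / K b) + (C b - K b - 1) * v b) / ((K b - 1) * b)) (at b)" .
    assume "v b / (K b - 1) < 0"
    then have vneg: "v b < 0" using Kb(1) by (simp add: divide_less_0_iff)
    have "t b + 1 / t b - K b - 1 / K b = (t b - K b) * (1 - 1 / (t b * K b))"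
      using tb Kb(1) by (simp add: field_simps)
    also have "\<dots> \<ge> 0"
      using tK[OF b] tb Kb(1) mult_mono[of 1 "t b" 1 "K b"] by (intro mult_nonneg_nonneg) auto
    finally have 1: "0 \<le> 2 * (a - 2) * (t b + 1 / t b - K b - 1 / K b)" using a by simp
    \<comment> \<open>The bounds t_(a-1) >= K and t <= 2K give at most (2 - c) K - 1 + (2a - 2) / K,
      which is largest at K = 1 with value -(m + 1). Without the division by K - 1 the same
      estimates would give only 1 - m for the factor of v.\<close>
    have "C b - K b - 1 \<le> 0"
    proof -
      have "K b \<le> A_ratio (a - 1) b" using cosh_ratio_le_A_ratio[OF b, of "a - 1"] a by (simp add: K_def)
      then have "(a - 1) / A_ratio (a - 1) b \<le> (a - 1) / K b" using Kb(1) a by (intro divide_left_mono) auto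
      then have dt: "(c - 1) * K b - (a - 1) / K b \<le> d * t b" using rec[OF b] by linarith
      have "1 + (t b)\<^sup>2 \<le> 2 * K b * t b" using A_ratio_quadratic[OF b, of a] by (simp add: t_def K_def)
      then have "t b * t b \<le> (2 * K b) * t b" by (simp add: power2_eq_square)
      then have "t b \<le> 2 * K b" using tb by (simp add: mult_le_cancel_right)
      then have t2: "1 / K b \<le> 2 / t b" using tb Kb(1) by (simp add: field_simps)
      have "(2 - c) * K b \<le> (2 - c) * 1"
        using Kb(1) a m_ge by (intro mult_left_mono_neg) (auto simp: c_def)
      moreover have "(2 * a - 2) * (1 / K b) \<le> (2 * a - 2) * 1"
        using Kb(1) a by (intro mult_left_mono) auto
      moreover have "C b - K b - 1 \<le> (2 - c) * K b - 1 + (2 * a - 2) * (1 / K b)"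
      proof -
        define I J where "I = 1 / K b" and "J = 2 / t b"
        have "(c - 1) * K b - (a - 1) * I \<le> d * t b" "I \<le> J" using dt t2 by (simp_all add: I_def J_def)
        then show ?thesis unfolding C_def I_def[symmetric] J_def[symmetric] by (simp add: algebra_simps)
      qed
      ultimately have "C b - K b - 1 \<le> (2 - c) * 1 - 1 + (2 * a - 2) * 1" by (smt (verit))
      then show ?thesis using m_ge by (simp add: c_def)
    qed
    then have "0 \<le> (C b - K b - 1) * v b" using vneg by (intro mult_nonpos_nonpos) auto
    with 1 Kb(1) b show "0 \<le> (2 * (a - 2) * (t b + 1 / t b - K b - 1 / K b) + (C b - K b - 1) * v b) / ((K b - 1) * b)"
      by (intro divide_nonneg_nonneg add_nonneg_nonneg[OF 1]) auto
  next
    \<comment> \<open>K - 1 is of order b^2, so the second-order coefficient of v must vanish. It is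
      assembled from the expansions of the ratios at a - 1 and a, and the contributions
      cancel.\<close>
    let ?X = "\<lambda>a b. (1 - 1 / A_ratio a b) / b\<^sup>2"
    have "((\<lambda>b. t b * ((1 - b\<^sup>2) / 2) * ((a - 1) * ?X (a - 1) b - 2 / (1 + b\<^sup>2) - (a - 2) * ?X a b)) \<longlongrightarrow>
      1 * ((1 - 0\<^sup>2) / 2) * ((a - 1) * (2 * (m + 2 * (a - 1)) / (m + 2)) - 2 / (1 + 0\<^sup>2) - (a - 2) * (2 * (m + 2 * a) / (m + 2)))) (at_right 0)"
      unfolding t_def by (intro tendsto_intros A_ratio_tendsto_1 A_ratio_expansion) auto
    moreover have "(a - 1) * (2 * (m + 2 * (a - 1)) / (m + 2)) - 2 / (1 + 0\<^sup>2) - (a - 2) * (2 * (m + 2 * a) / (m + 2)) = 0"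
      using m_ge by (simp add: field_simps)
    ultimately have "((\<lambda>b. t b * ((1 - b\<^sup>2) / 2) * ((a - 1) * ?X (a - 1) b - 2 / (1 + b\<^sup>2) - (a - 2) * ?X a b)) \<longlongrightarrow> 0) (at_right 0)"
      by simp
    moreover have "eventually (\<lambda>b. t b * ((1 - b\<^sup>2) / 2) * ((a - 1) * ?X (a - 1) b - 2 / (1 + b\<^sup>2) - (a - 2) * ?X a b)
        = v b / (K b - 1)) (at_right 0)"
      unfolding eventually_at_right_field
    proof (intro exI[of _ 1] conjI allI impI)
      fix b :: real assume b: "0 < b" "b < 1"
      let ?s = "A_ratio (a - 1) b"
      have tb: "1 < t b" using tK[OF b] K(1)[OF b] by simp
      have "0 < 1 + b\<^sup>2" by (simp add: add_pos_nonneg)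
      then have sK: "2 * b\<^sup>2 / (1 + b\<^sup>2) = 1 - 1 / K b"
        by (simp add: K_def cosh_ratio_def divide_simps)
      have "v b = t b * (d * t b - (c - 1) * K b + 1 / K b) + (a - 2)"
        by (simp add: v_def power2_eq_square algebra_simps)
      also have "d * t b - (c - 1) * K b = - ((a - 1) / ?s)" using rec[OF b] by simp
      finally have "v b = t b * (- ((a - 1) / ?s) + 1 / K b) + (a - 2)" .
      moreover have "t b * ((a - 2) / t b) = a - 2" using tb by simp
      ultimately have "v b = t b * (1 / K b - (a - 1) / ?s + (a - 2) / t b)"
        unfolding distrib_left right_diff_distrib by linarith
      also have "1 / K b - (a - 1) / ?s + (a - 2) / t b = (a - 1) * (1 - 1 / ?s) - (1 - 1 / K b) - (a - 2) * (1 - 1 / t b)"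
        by (simp add: right_diff_distrib)
      also have "\<dots> = ((a - 1) * ?X (a - 1) b - 2 / (1 + b\<^sup>2) - (a - 2) * ?X a b) * b\<^sup>2"
      proof -
        have "e * P - 2 * b\<^sup>2 / w - f * Q = (e * (P / b\<^sup>2) - 2 / w - f * (Q / b\<^sup>2)) * b\<^sup>2" for e f P Q w
          using b by (simp add: left_diff_distrib)
        then show ?thesis unfolding sK[symmetric] t_def .
      qed
      finally show "t b * ((1 - b\<^sup>2) / 2) * ((a - 1) * ?X (a - 1) b - 2 / (1 + b\<^sup>2) - (a - 2) * ?X a b) = v b / (K b - 1)"
        using b unfolding K(3)[OF b] by simp
    qed simp
    ultimately show "((\<lambda>b. v b / (K b - 1)) \<longlongrightarrow> 0) (at_right 0)"
      by (rule Lim_transform_eventually)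
  qed (use b in auto)
  then have "0 \<le> v b" using K(1)[OF b] by (simp add: zero_le_divide_iff)
  then show ?thesis by (simp add: v_def t_def K_def c_def d_def)
qed

text \<open>This is b^2 times the radial Laplacian of D, divided by 2 a^2 b^2 A_(a-1), with the term
  in B_(a-1) replaced by its Jensen bound. It tends to 0 at b = 0, and its derivative has a
  nonnegative numerator on all of (0, 1), not only where the function is negative.\<close>

lemma laplacian_bound_nonneg:
  assumes b: "0 < b" "b < 1" and a: "2 \<le> a"
  shows "0 \<le> (m + a) * (A_ratio a b - 1) - (m + 2 * a - 1) * (cosh_ratio b - 1)
    + (A_ratio a b - 1)\<^sup>2 / (A_ratio a b * (cosh_ratio b - 1)) - (m + 2 * a) * ((1 - 1 / a) * ln (A a b) - ln (A (a - 1) b))"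
proof -
  define t where "t = A_ratio a"
  define K where "K = cosh_ratio"
  define c d where "c = m + 2 * a" and "d = m + a"
  define u where "u b = (c - 1) * K b * t b - d * (t b)\<^sup>2 - (a - 1)" for b
  define P where "P b = u b * ((K b - 1) * (d * (t b)\<^sup>2 - (c + K b) * t b) + (t b)\<^sup>2 - 1) + (K b - 1) * (a - 1) * t b * (t b - K b) + (t b - 1) * (2 * K b * t b - 1 - (t b)\<^sup>2)" for b
  let ?G = "\<lambda>b. d * (t b - 1) - (c - 1) * (K b - 1) + (t b - 1)\<^sup>2 / (t b * (K b - 1)) - c * ((1 - 1 / a) * ln (A a b) - ln (A (a - 1) b))"
  have K: "1 < K b" "(K has_real_derivative ((K b)\<^sup>2 - 1) / b) (at b)" "K b - 1 = 2 * b\<^sup>2 / (1 - b\<^sup>2)" if "0 < b" "b < 1" for b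
    using cosh_ratio[OF that] by (simp_all add: K_def)
  have tK: "K b \<le> t b" if "0 < b" "b < 1" for b
    using cosh_ratio_le_A_ratio[OF that] a by (simp add: K_def t_def)
  have rec: "d * t b + (a - 1) / A_ratio (a - 1) b = (c - 1) * K b" if "0 < b" "b < 1" for b
    using A_ratio_recurrence[OF that, of a] by (simp add: c_def d_def t_def K_def)
  have "0 \<le> ?G b"
  proof (rule nonneg_if_DERIV_nonneg_where_negative[where f = ?G and h = 1 and f' = "\<lambda>b. P b / ((t b)\<^sup>2 * (K b - 1)) / b"])
    fix b :: real assume b: "0 < b" "b < 1"
    note Kb = K[OF b]
    have tb: "1 < t b" using tK[OF b] Kb by simp
    have s: "0 < A_ratio (a - 1) b" using A_ratio_pos[of b "a - 1"] b by simp
    let ?N = "c * K b * t b - d * (t b)\<^sup>2 - a"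
    have t': "(t has_real_derivative ?N / b) (at b)"
      using A_ratio_deriv[OF b, of a] by (simp add: t_def K_def c_def d_def)
    \<comment> \<open>By the recurrence u measures how much the ratio drops from exponent a to a -
      1. This form shows u >= 0 and identifies the derivative of the logarithmic term.\<close>
    have ut: "u b / t b = (a - 1) * (1 / A_ratio (a - 1) b - 1 / t b)"
    proof -
      have "u b = t b * ((c - 1) * K b - d * t b) - (a - 1)" by (simp add: u_def power2_eq_square algebra_simps)
      also have "(c - 1) * K b - d * t b = (a - 1) / A_ratio (a - 1) b" using rec[OF b] by simp
      finally show ?thesis using tb by (simp add: diff_divide_distrib right_diff_distrib)
    qed
    have "((\<lambda>b. (1 - 1 / a) * ln (A a b) - ln (A (a - 1) b)) has_real_derivative
       (1 - 1 / a) * (a * (1 - 1 / A_ratio a b) / b) - (a - 1) * (1 - 1 / A_ratio (a - 1) b) / b) (at b)"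
      by (intro DERIV_diff DERIV_cmult ln_A_deriv b)
    also have "(1 - 1 / a) * (a * (1 - 1 / A_ratio a b) / b) - (a - 1) * (1 - 1 / A_ratio (a - 1) b) / b = u b / t b / b"
    proof -
      have "(1 - 1 / a) * a = a - 1" using a by (simp add: field_simps)
      then have eq: "(1 - 1 / a) * (a * X / b) = (a - 1) * X / b" for X
        by (metis mult.assoc times_divide_eq_right)
      show ?thesis unfolding ut eq by (simp add: t_def diff_divide_distrib right_diff_distrib)
    qed
    finally have psi: "((\<lambda>b. (1 - 1 / a) * ln (A a b) - ln (A (a - 1) b)) has_real_derivative u b / t b / b) (at b)" .
    have frac: "((\<lambda>b. (t b - 1)\<^sup>2 / (t b * (K b - 1))) has_real_derivative
        ((1 - 1 / (t b)\<^sup>2) * ?N / (K b - 1) - (t b - 1)\<^sup>2 * (K b + 1) / (t b * (K b - 1))) / b) (at b)"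
    proof -
      have "((\<lambda>b. (t b - 1)\<^sup>2 / (t b * (K b - 1))) has_real_derivative
        (2 * (t b - 1) * (?N / b) * (t b * (K b - 1)) - (t b - 1)\<^sup>2 * (?N / b * (K b - 1) + (((K b)\<^sup>2 - 1) / b) * t b)) / ((t b * (K b - 1)) * (t b * (K b - 1)))) (at b)"
        using Kb(1) tb by (auto intro!: derivative_eq_intros t' Kb(2))
      also have "(2 * (t b - 1) * (?N / b) * (t b * (K b - 1)) - (t b - 1)\<^sup>2 * (?N / b * (K b - 1) + (((K b)\<^sup>2 - 1) / b) * t b)) / ((t b * (K b - 1)) * (t b * (K b - 1)))
        = ((1 - 1 / (t b)\<^sup>2) * ?N / (K b - 1) - (t b - 1)\<^sup>2 * (K b + 1) / (t b * (K b - 1))) / b"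
      proof -
        define k where "k = K b - 1"
        have k: "0 < k" "K b = 1 + k" using Kb(1) by (auto simp: k_def)
        have "(2 * (x - 1) * (N / b) * (x * k) - (x - 1)\<^sup>2 * (N / b * k + (((1 + k)\<^sup>2 - 1) / b) * x)) / ((x * k) * (x * k))
          = ((1 - 1 / x\<^sup>2) * N / k - (x - 1)\<^sup>2 * ((1 + k) + 1) / (x * k)) / b" if "1 < x" for x N
          using that k(1) b by (simp add: divide_simps) (simp add: power2_eq_square algebra_simps)
        from this[OF tb] show ?thesis by (simp add: k)
      qed
      finally show ?thesis .
    qed
    have "(?G has_real_derivative d * (?N / b) - (c - 1) * (((K b)\<^sup>2 - 1) / b)
        + ((1 - 1 / (t b)\<^sup>2) * ?N / (K b - 1) - (t b - 1)\<^sup>2 * (K b + 1) / (t b * (K b - 1))) / b - c * (u b / t b / b)) (at b)"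
      by (intro DERIV_diff DERIV_add DERIV_cmult psi frac)
        (auto intro!: derivative_eq_intros t' Kb(2))
    also have "d * (?N / b) - (c - 1) * (((K b)\<^sup>2 - 1) / b)
        + ((1 - 1 / (t b)\<^sup>2) * ?N / (K b - 1) - (t b - 1)\<^sup>2 * (K b + 1) / (t b * (K b - 1))) / b - c * (u b / t b / b)
      = (d * ?N - (c - 1) * ((K b)\<^sup>2 - 1) + ((1 - 1 / (t b)\<^sup>2) * ?N / (K b - 1) - (t b - 1)\<^sup>2 * (K b + 1) / (t b * (K b - 1))) - c * (u b / t b)) / b"
    proof -
      have "d * (N / b) - e * (M / b) + F / b - c * (U / b) = (d * N - e * M + F - c * U) / b" for N M F U e
        by (simp add: add_divide_distrib diff_divide_distrib)
      then show ?thesis .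
    qed
    also have "d * ?N - (c - 1) * ((K b)\<^sup>2 - 1) + ((1 - 1 / (t b)\<^sup>2) * ?N / (K b - 1) - (t b - 1)\<^sup>2 * (K b + 1) / (t b * (K b - 1))) - c * (u b / t b)
      = P b / ((t b)\<^sup>2 * (K b - 1))"
      unfolding P_def u_def
      by (rule laplacian_bound_derivative) (use tb Kb(1) in \<open>auto simp: c_def d_def\<close>)
    finally show "(?G has_real_derivative P b / ((t b)\<^sup>2 * (K b - 1)) / b) (at b)" .
    have "0 \<le> P b"
      unfolding P_def
    proof (rule barrier_polynomial_nonneg)
      show "2 \<le> a" "3 \<le> c" "d = c - a" "0 \<le> d" "K b - 1 = K b - 1" "0 < K b - 1" "K b \<le> t b"
        using a m_ge Kb tK[OF b] by (auto simp: c_def d_def)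
      show "1 + (t b)\<^sup>2 \<le> 2 * K b * t b" using A_ratio_quadratic[OF b, of a] by (simp add: t_def K_def)
      have "1 / t b \<le> 1 / A_ratio (a - 1) b"
        using A_ratio_mono[OF b, of a] s by (intro divide_left_mono) (auto simp: t_def)
      then have "0 \<le> u b / t b" unfolding ut using a by (intro mult_nonneg_nonneg) auto
      then show "0 \<le> u b" using tb by (simp add: zero_le_divide_iff)
      \<comment> \<open>The barrier function equals t / K - 1 - u, so its nonnegativity is exactly
        the upper bound on u required here.\<close>
      have "0 \<le> K b * (d * (t b)\<^sup>2 - ((c - 1) * K b - 1 / K b) * t b + (a - 2))"
        using Riccati_barrier_nonneg[OF b a] Kb(1) by (simp add: t_def K_def c_def d_def)
      also have "\<dots> = t b - K b - u b * K b"
        using Kb(1) by (simp add: u_def algebra_simps)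
      finally show "u b * K b \<le> t b - K b" by simp
    qed
    then show "0 \<le> P b / ((t b)\<^sup>2 * (K b - 1)) / b" using tb Kb(1) b by simp
  next
    let ?X = "\<lambda>b. (1 - 1 / t b) / b\<^sup>2"
    have X: "(?X \<longlongrightarrow> 2 * (m + 2 * a) / (m + 2)) (at_right 0)"
      unfolding t_def by (rule A_ratio_expansion)
    have t1: "(t \<longlongrightarrow> 1) (at_right 0)" unfolding t_def by (rule A_ratio_tendsto_1)
    have K1: "(K \<longlongrightarrow> 1) (at_right 0)" unfolding K_def by (rule cosh_ratio_tendsto_1)
    \<comment> \<open>The numerator (t - 1)^2 is of order b^4 and K - 1 of order b^2; rewriting
      through ?X makes the factor b^2 explicit.\<close>
    have "((\<lambda>b. (?X b)\<^sup>2 * t b * b\<^sup>2 * ((1 - b\<^sup>2) / 2)) \<longlongrightarrow> (2 * (m + 2 * a) / (m + 2))\<^sup>2 * 1 * 0\<^sup>2 * ((1 - 0\<^sup>2) / 2)) (at_right 0)"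
      by (intro tendsto_intros X t1) auto
    moreover have "eventually (\<lambda>b. (?X b)\<^sup>2 * t b * b\<^sup>2 * ((1 - b\<^sup>2) / 2) = (t b - 1)\<^sup>2 / (t b * (K b - 1))) (at_right 0)"
      unfolding eventually_at_right_field
    proof (intro exI[of _ 1] conjI allI impI)
      fix b :: real assume b: "0 < b" "b < 1"
      have tb: "1 < t b" using tK[OF b] K(1)[OF b] by simp
      have "?X b = (t b - 1) / (t b * b\<^sup>2)" using tb by (simp add: field_simps)
      then show "(?X b)\<^sup>2 * t b * b\<^sup>2 * ((1 - b\<^sup>2) / 2) = (t b - 1)\<^sup>2 / (t b * (K b - 1))"
        using tb b unfolding K(3)[OF b] by (simp add: power2_eq_square)
    qed simp
    ultimately have f: "((\<lambda>b. (t b - 1)\<^sup>2 / (t b * (K b - 1))) \<longlongrightarrow> (2 * (m + 2 * a) / (m + 2))\<^sup>2 * 1 * 0\<^sup>2 * ((1 - 0\<^sup>2) / 2)) (at_right 0)"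
      by (rule Lim_transform_eventually)
    have "(?G \<longlongrightarrow> d * (1 - 1) - (c - 1) * (1 - 1) + (2 * (m + 2 * a) / (m + 2))\<^sup>2 * 1 * 0\<^sup>2 * ((1 - 0\<^sup>2) / 2)
       - c * ((1 - 1 / a) * ln 1 - ln 1)) (at_right 0)"
      by (intro tendsto_intros t1 K1 f A_tendsto_0) auto
    then show "(?G \<longlongrightarrow> 0) (at_right 0)" by simp
  qed (use b in auto)
  then show ?thesis by (simp add: t_def K_def c_def d_def)
qed

end

subsection \<open>The logarithmic Sobolev inequality\<close>

context circle_measure
begin

text \<open>The left side is the entropy of V^a. At order b^2 both sides equal 2 a^2 b^2 / (m + 2),
  so the constant is the smallest possible and the difference starts beyond second order.\<close>

lemma log_Sobolev:
  assumes b: "0 < b" "b < 1" and a: "2 \<le> a"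
  shows "a * B a b - A a b * ln (A a b) \<le> a\<^sup>2 / (m + 2 * a) * (A a b - (1 - b\<^sup>2) * A (a - 1) b)"
proof -
  define c where "c = m + 2 * a"
  have c: "3 \<le> c" using a m_ge by (simp add: c_def)
  \<comment> \<open>\<open>Y\<close> is \<open>b D'\<close>, and \<open>Z\<close> is \<open>b\<^sup>2\<close> times the radial Laplacian of \<open>D\<close>.\<close>
  define D where "D b = a\<^sup>2 / c * (A a b - (1 - b\<^sup>2) * A (a - 1) b) - a * B a b + A a b * ln (A a b)" for b
  define Y where "Y b = a\<^sup>2 / c * ((m + (2 * a + c) * b\<^sup>2) * A (a - 1) b - m * A a b) - a\<^sup>2 * (B a b - (1 - b\<^sup>2) * B (a - 1) b)
      + a * (A a b - (1 - b\<^sup>2) * A (a - 1) b) * ln (A a b)" for b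
  define Z where "Z b = 2 * a\<^sup>2 * b\<^sup>2 * (a - 1) * (A (a - 1) b - (1 - b\<^sup>2) * A (a - 2) b)
      + 2 * a * c * b\<^sup>2 * (A (a - 1) b * ln (A a b) - a * B (a - 1) b)
      + (a * (A a b - (1 - b\<^sup>2) * A (a - 1) b))\<^sup>2 / A a b" for b
  have D': "(D has_real_derivative Y b / b) (at b)" if b: "0 < b" "b < 1" for b
  proof -
    have Ap: "0 < A a b" using A_pos b by simp
    define A0 A1 A2 B0 B1 L where "A0 = A a b" and "A1 = A (a - 1) b" and "A2 = A (a - 2) b"
      and "B0 = B a b" and "B1 = B (a - 1) b" and "L = ln (A a b)"
    define dA0 dA1 dB0 where "dA0 = a * (A0 - (1 - b\<^sup>2) * A1) / b" and "dA1 = (a - 1) * (A1 - (1 - b\<^sup>2) * A2) / b"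
      and "dB0 = (a * (B0 - (1 - b\<^sup>2) * B1) + A0 - (1 - b\<^sup>2) * A1) / b"
    have d: "(A a has_real_derivative dA0) (at b)" "(A (a - 1) has_real_derivative dA1) (at b)" "(B a has_real_derivative dB0) (at b)"
      using A_deriv[OF b, of a] A_deriv[OF b, of "a - 1"] B_deriv[OF b, of a]
      by (simp_all add: dA0_def dA1_def dB0_def A0_def A1_def A2_def B0_def B1_def)
    have "(D has_real_derivative a\<^sup>2 / c * (dA0 - (- (2 * b) * A1 + (1 - b\<^sup>2) * dA1)) - a * dB0 + (dA0 * L + dA0)) (at b)"
      unfolding D_def A1_def L_def using Ap c
      by (auto intro!: derivative_eq_intros d)
    also have "a\<^sup>2 / c * (dA0 - (- (2 * b) * A1 + (1 - b\<^sup>2) * dA1)) - a * dB0 + (dA0 * L + dA0) = Y b / b"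
    proof -
      have e: "b * dA0 = a * (A0 - (1 - b\<^sup>2) * A1)" "b * dA1 = (a - 1) * (A1 - (1 - b\<^sup>2) * A2)"
        "b * dB0 = a * (B0 - (1 - b\<^sup>2) * B1) + A0 - (1 - b\<^sup>2) * A1"
        using b by (simp_all add: dA0_def dA1_def dB0_def)
      have r: "(m + a) * A0 - (m + 2 * a - 1) * (1 + b\<^sup>2) * A1 + (a - 1) * (1 - b\<^sup>2)\<^sup>2 * A2 = 0"
        using A_recurrence[of b a] b by (simp add: A0_def A1_def A2_def)
      have "b * (a\<^sup>2 / c * (dA0 - (- (2 * b) * A1 + (1 - b\<^sup>2) * dA1)) - a * dB0 + (dA0 * L + dA0))
        = a\<^sup>2 / c * (b * dA0 - (- (2 * b) * b * A1 + (1 - b\<^sup>2) * (b * dA1))) - a * (b * dB0) + (b * dA0 * L + b * dA0)"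
        by (simp add: algebra_simps)
      \<comment> \<open>The recurrence removes A_(a-2), which is why \<open>Y\<close> contains only
        exponents a and a - 1.\<close>
      also have "b * dA0 - (- (2 * b) * b * A1 + (1 - b\<^sup>2) * (b * dA1)) = (m + (2 * a + c) * b\<^sup>2) * A1 - m * A0"
        unfolding e c_def using r by algebra
      also have "a\<^sup>2 / c * ((m + (2 * a + c) * b\<^sup>2) * A1 - m * A0) - a * (b * dB0) + (b * dA0 * L + b * dA0) = Y b"
        unfolding e Y_def A0_def A1_def B0_def B1_def L_def by (simp add: power2_eq_square algebra_simps)
      finally show ?thesis using b by (simp add: field_simps)
    qed
    finally show ?thesis .
  qed
  \<comment> \<open>Equivalently the derivative of b^m Y is b^(m-1) Z, so the sign of Z passes to Y
    through an integrating factor.\<close>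
  have Y': "(Y has_real_derivative (Z b - m * Y b) / b) (at b)" if b: "0 < b" "b < 1" for b
  proof -
    have Ap: "0 < A a b" using A_pos b by simp
    define A0 A1 A2 B0 B1 B2 L where "A0 = A a b" and "A1 = A (a - 1) b" and "A2 = A (a - 2) b"
      and "B0 = B a b" and "B1 = B (a - 1) b" and "B2 = B (a - 2) b" and "L = ln (A a b)"
    define dA0 dA1 dB0 dB1 where "dA0 = a * (A0 - (1 - b\<^sup>2) * A1) / b" and "dA1 = (a - 1) * (A1 - (1 - b\<^sup>2) * A2) / b"
      and "dB0 = (a * (B0 - (1 - b\<^sup>2) * B1) + A0 - (1 - b\<^sup>2) * A1) / b"
      and "dB1 = ((a - 1) * (B1 - (1 - b\<^sup>2) * B2) + A1 - (1 - b\<^sup>2) * A2) / b"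
    have d: "(A a has_real_derivative dA0) (at b)" "(A (a - 1) has_real_derivative dA1) (at b)" "(B a has_real_derivative dB0) (at b)"
      "(B (a - 1) has_real_derivative dB1) (at b)"
      using A_deriv[OF b, of a] A_deriv[OF b, of "a - 1"] B_deriv[OF b, of a] B_deriv[OF b, of "a - 1"]
      by (simp_all add: dA0_def dA1_def dB0_def dB1_def A0_def A1_def A2_def B0_def B1_def B2_def)
    have "(Y has_real_derivative a\<^sup>2 / c * ((2 * a + c) * (2 * b) * A1 + (m + (2 * a + c) * b\<^sup>2) * dA1 - m * dA0)
        - a\<^sup>2 * (dB0 - (- (2 * b) * B1 + (1 - b\<^sup>2) * dB1))
        + (a * (dA0 - (- (2 * b) * A1 + (1 - b\<^sup>2) * dA1)) * L + a * (A0 - (1 - b\<^sup>2) * A1) * (dA0 / A0))) (at b)"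
      unfolding Y_def A0_def A1_def B1_def L_def using Ap c
      by (auto intro!: derivative_eq_intros d simp: algebra_simps add_divide_distrib diff_divide_distrib)
    also have "a\<^sup>2 / c * ((2 * a + c) * (2 * b) * A1 + (m + (2 * a + c) * b\<^sup>2) * dA1 - m * dA0)
        - a\<^sup>2 * (dB0 - (- (2 * b) * B1 + (1 - b\<^sup>2) * dB1))
        + (a * (dA0 - (- (2 * b) * A1 + (1 - b\<^sup>2) * dA1)) * L + a * (A0 - (1 - b\<^sup>2) * A1) * (dA0 / A0)) = (Z b - m * Y b) / b"
      (is "?lhs = _")
    proof -
      have e: "b * dA0 = a * (A0 - (1 - b\<^sup>2) * A1)" "b * dA1 = (a - 1) * (A1 - (1 - b\<^sup>2) * A2)"
        "b * dB0 = a * (B0 - (1 - b\<^sup>2) * B1) + A0 - (1 - b\<^sup>2) * A1"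
        "b * dB1 = (a - 1) * (B1 - (1 - b\<^sup>2) * B2) + A1 - (1 - b\<^sup>2) * A2"
        using b by (simp_all add: dA0_def dA1_def dB0_def dB1_def)
      \<comment> \<open>Both recurrences are needed: the second one is what eliminates
        \<open>B2\<close>, the logarithmic moment at exponent a - 2.\<close>
      have r: "(m + a) * A0 - (m + 2 * a - 1) * (1 + b\<^sup>2) * A1 + (a - 1) * (1 - b\<^sup>2)\<^sup>2 * A2 = 0"
        "A0 + (m + a) * B0 - 2 * (1 + b\<^sup>2) * A1 - (m + 2 * a - 1) * (1 + b\<^sup>2) * B1
          + (1 - b\<^sup>2)\<^sup>2 * A2 + (a - 1) * (1 - b\<^sup>2)\<^sup>2 * B2 = 0"
        using A_recurrence[of b a] B_recurrence[of b a] b by (simp_all add: A0_def A1_def A2_def B0_def B1_def B2_def)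
      define q where "q = a\<^sup>2 / c"
      have q: "q * c = a\<^sup>2" using c by (simp add: q_def)
      have "b * ?lhs = q * ((2 * a + c) * (2 * b * b) * A1 + (m + (2 * a + c) * b\<^sup>2) * (b * dA1) - m * (b * dA0))
        - a\<^sup>2 * (b * dB0 - (- (2 * b * b) * B1 + (1 - b\<^sup>2) * (b * dB1)))
        + a * (b * dA0 - (- (2 * b * b) * A1 + (1 - b\<^sup>2) * (b * dA1))) * L + a * (A0 - (1 - b\<^sup>2) * A1) * (b * dA0) / A0"
      proof -
        have "b * (q * P - a\<^sup>2 * Q + (R * L + S * (dA0 / A0))) = q * (b * P) - a\<^sup>2 * (b * Q) + b * R * L + S * (b * dA0) / A0" for P Q R S
          by (simp add: algebra_simps)
        then show ?thesis unfolding q_def[symmetric] by (simp only:) (simp add: algebra_simps)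
      qed
      also have "a * (A0 - (1 - b\<^sup>2) * A1) * (b * dA0) / A0 = (a * (A0 - (1 - b\<^sup>2) * A1))\<^sup>2 / A0"
        unfolding e by (simp add: power2_eq_square)
      also have "q * ((2 * a + c) * (2 * b * b) * A1 + (m + (2 * a + c) * b\<^sup>2) * (b * dA1) - m * (b * dA0))
        - a\<^sup>2 * (b * dB0 - (- (2 * b * b) * B1 + (1 - b\<^sup>2) * (b * dB1)))
        + a * (b * dA0 - (- (2 * b * b) * A1 + (1 - b\<^sup>2) * (b * dA1))) * L
        = 2 * a\<^sup>2 * b\<^sup>2 * (a - 1) * (A1 - (1 - b\<^sup>2) * A2) + 2 * a * c * b\<^sup>2 * (A1 * L - a * B1)
         - m * (q * ((m + (2 * a + c) * b\<^sup>2) * A1 - m * A0) - a\<^sup>2 * (B0 - (1 - b\<^sup>2) * B1)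
      + a * (A0 - (1 - b\<^sup>2) * A1) * L)"
        unfolding e c_def using r q[unfolded c_def] by algebra
      also have "\<dots> + (a * (A0 - (1 - b\<^sup>2) * A1))\<^sup>2 / A0 = Z b - m * Y b"
        unfolding Z_def Y_def q_def A0_def A1_def A2_def B0_def B1_def L_def by simp
      finally show ?thesis using b by (simp add: field_simps)
    qed
    finally show ?thesis .
  qed
  have Z: "0 \<le> Z b" if b: "0 < b" "b < 1" for b
  proof -
    have b1: "\<bar>b\<bar> < 1" "0 < 1 - b\<^sup>2" using b by (auto simp: power_less_one_iff)
    note pos = A_pos[OF b1(1), of a] A_pos[OF b1(1), of "a - 1"] A_pos[OF b1(1), of "a - 2"]
    define t K where "t = A_ratio a b" and "K = cosh_ratio b"
    have tp: "0 < t" using A_ratio_pos[OF b1(1)] by (simp add: t_def)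
    have Kp: "1 < K" "K - 1 = 2 * b\<^sup>2 / (1 - b\<^sup>2)" using cosh_ratio[OF b] by (simp_all add: K_def)
    define G where "G = (m + a) * (t - 1) - (c - 1) * (K - 1) + (t - 1)\<^sup>2 / (t * (K - 1))
      - c * ((1 - 1 / a) * ln (A a b) - ln (A (a - 1) b))"
    have G: "0 \<le> G" using laplacian_bound_nonneg[OF b a] by (simp add: G_def t_def K_def c_def)
    have "B (a - 1) b / A (a - 1) b \<le> ln (A a b) - ln (A (a - 1) b)"
      using B_Jensen[OF b1(1), of a] pos by (simp add: ln_div field_simps)
    then have J: "c * (ln (A a b) / a - B (a - 1) b / A (a - 1) b) \<ge> - (c * ((1 - 1 / a) * ln (A a b) - ln (A (a - 1) b)))"
      using c mult_left_mono[of "B (a - 1) b / A (a - 1) b" "ln (A a b) - ln (A (a - 1) b)" c] by (simp add: algebra_simps)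
    have s: "A (a - 1) b - (1 - b\<^sup>2) * A (a - 2) b = A (a - 1) b * (1 - 1 / A_ratio (a - 1) b)"
      using pos b1 by (simp add: A_ratio_def right_diff_distrib)
    have r: "(a - 1) * (1 - 1 / A_ratio (a - 1) b) = (m + a) * (t - 1) - (c - 1) * (K - 1)"
      using A_ratio_recurrence[OF b, of a] by (simp add: t_def K_def c_def algebra_simps)
    have tq: "(a * (A a b - (1 - b\<^sup>2) * A (a - 1) b))\<^sup>2 / A a b
      = 2 * a\<^sup>2 * b\<^sup>2 * A (a - 1) b * ((t - 1)\<^sup>2 / (t * (K - 1)))"
    proof -
      have "A a b = t * (1 - b\<^sup>2) * A (a - 1) b" using pos b1 by (simp add: t_def A_ratio_def)
      moreover have "(a * (t * d * x - d * x))\<^sup>2 / (t * d * x) = 2 * a\<^sup>2 * b\<^sup>2 * x * ((t - 1)\<^sup>2 / (t * (2 * b\<^sup>2 / d)))"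
        if "0 < d" "0 < x" for d x
      proof -
        have "t * d * x - d * x = d * x * (t - 1)" by (simp add: algebra_simps)
        then show ?thesis using that tp b by (simp add: power_mult_distrib) (simp add: power2_eq_square)
      qed
      ultimately show ?thesis unfolding Kp(2) using pos b1 by (simp only:)
    qed
    \<comment> \<open>After the common factor is taken out, only the last summand is not a function
      of t, K and logarithms of moments; \<open>J\<close> bounds it below, and the bracket is then
      at least \<open>G\<close>.\<close>
    have "Z b = 2 * a\<^sup>2 * b\<^sup>2 * A (a - 1) b * ((m + a) * (t - 1) - (c - 1) * (K - 1) + (t - 1)\<^sup>2 / (t * (K - 1))
        + c * (ln (A a b) / a - B (a - 1) b / A (a - 1) b))"
    proof -
      have eq: "2 * a * c * b\<^sup>2 * (A (a - 1) b * ln (A a b) - a * B (a - 1) b)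
        = 2 * a\<^sup>2 * b\<^sup>2 * A (a - 1) b * (c * (ln (A a b) / a - B (a - 1) b / A (a - 1) b))"
        using pos a by (simp add: field_simps power2_eq_square)
      show ?thesis unfolding Z_def s r[symmetric] tq eq by (simp only: distrib_left mult_ac add_ac)
    qed
    also have "\<dots> \<ge> 2 * a\<^sup>2 * b\<^sup>2 * A (a - 1) b * G"
      using J pos by (intro mult_left_mono) (auto simp: G_def)
    finally show ?thesis using G pos by (smt (verit) mult_nonneg_nonneg zero_le_power2)
  qed
  have Y0: "((\<lambda>b. Y b / b) \<longlongrightarrow> 0) (at_right 0)"
  proof -
    have "A x 0 = 1" "B x 0 = 0" for x by (simp_all add: A_def B_def V_def prob_space)
    moreover have "(Y has_real_derivative 0) (at 0)"
      unfolding Y_def using A_deriv_0 B_deriv_0 calculation c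
      by (auto intro!: derivative_eq_intros)
    moreover have "Y 0 = 0" unfolding Y_def by (simp add: calculation)
    ultimately have "((\<lambda>b. Y b / b) \<longlongrightarrow> 0) (at 0)"
      unfolding has_field_derivative_iff by simp
    then show ?thesis by (rule filterlim_mono) (auto intro: at_le)
  qed
  have Ynn: "0 \<le> Y b" if b: "0 < b" "b < 1" for b
  proof -
    \<comment> \<open>b^m Y is b^(m+1) D', whose derivative is b^(m+1) times the radial Laplacian of
      D.\<close>
    have "0 \<le> b powr m * Y b"
    proof (rule nonneg_if_DERIV_nonneg_where_negative[where f = "\<lambda>b. b powr m * Y b" and h = 1 and f' = "\<lambda>b. b powr m * Z b / b"])
      fix b :: real assume b: "0 < b" "b < 1"
      have "((\<lambda>b. b powr m * Y b) has_real_derivative (m * b powr (m - 1)) * Y b + (Z b - m * Y b) / b * b powr m) (at b)"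
        by (intro DERIV_mult Y' has_real_derivative_powr b)
      also have "(m * b powr (m - 1)) * Y b + (Z b - m * Y b) / b * b powr m = b powr m * Z b / b"
        using b by (simp add: powr_diff field_simps)
      finally show "((\<lambda>b. b powr m * Y b) has_real_derivative b powr m * Z b / b) (at b)" .
      show "0 \<le> b powr m * Z b / b" using Z b by simp
    next
      \<comment> \<open>For negative m the factor b^m blows up, but m >= -1 gives b^m <= 1/b on (0,
        1), and Y / b tends to 0 because Y and its derivative vanish at 0.\<close>
      show "((\<lambda>b. b powr m * Y b) \<longlongrightarrow> 0) (at_right 0)"
      proof (rule Lim_null_comparison[OF _ tendsto_norm_zero[OF Y0]])
        show "\<forall>\<^sub>F b in at_right 0. norm (b powr m * Y b) \<le> norm (Y b / b)"
          unfolding eventually_at_right_field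
        proof (intro exI[of _ 1] conjI allI impI)
          fix b :: real assume b: "0 < b" "b < 1"
          have "b powr m \<le> b powr (- 1)" using b m_ge by (intro powr_mono') auto
          then have "b powr m * \<bar>Y b\<bar> \<le> b powr (- 1) * \<bar>Y b\<bar>" by (rule mult_right_mono) simp
          then show "norm (b powr m * Y b) \<le> norm (Y b / b)"
            using b by (simp add: abs_mult powr_minus divide_inverse mult.commute)
        qed simp
      qed
    qed (use b in auto)
    then show ?thesis using b by (simp add: zero_le_mult_iff)
  qed
  have "0 \<le> D b"
  proof (rule nonneg_if_DERIV_nonneg_where_negative[where f = D and h = 1 and f' = "\<lambda>b. Y b / b"])
    have e: "A x 0 = 1" "B x 0 = 0" for x by (simp_all add: A_def B_def V_def prob_space)
    have "isCont D 0"
      unfolding D_def using e DERIV_isCont[OF A_deriv_0] DERIV_isCont[OF B_deriv_0]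
      by (intro continuous_intros) auto
    moreover have "D 0 = 0" by (simp add: D_def e)
    ultimately have "(D \<longlongrightarrow> 0) (at 0)" by (simp add: isCont_def)
    then show "(D \<longlongrightarrow> 0) (at_right 0)" by (rule filterlim_mono) (auto intro: at_le)
  qed (use b D' Ynn in auto)
  then show ?thesis by (simp add: D_def c_def)
qed

end

subsection \<open>Comparison of norms\<close>

text \<open>Zero arguments are treated apart, since 1 + bz may vanish on the circle; there the
  inequality reduces to \<beta>^p <= \<beta> for \<beta> in [0, 1].\<close>

lemma powr_convex_nonneg:
  fixes u v \<alpha> p :: real
  assumes "0 \<le> u" "0 \<le> v" "0 \<le> \<alpha>" "\<alpha> \<le> 1" "1 \<le> p"
  shows "((1 - \<alpha>) * u + \<alpha> * v) powr p \<le> (1 - \<alpha>) * u powr p + \<alpha> * v powr p"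
proof -
  have *: "(\<beta> * w) powr p \<le> \<beta> * w powr p" if "0 \<le> \<beta>" "\<beta> \<le> 1" "0 \<le> w" for \<beta> w :: real
  proof -
    have "\<beta> powr p \<le> \<beta> powr 1" using that assms(5) by (intro powr_mono') auto
    then show ?thesis using that by (simp add: powr_mult mult_right_mono)
  qed
  consider "u = 0" | "v = 0" | "0 < u" "0 < v" using assms by linarith
  then show ?thesis
  proof cases
    case 1 then show ?thesis using *[of \<alpha> v] assms by simp
  next
    case 2 then show ?thesis using *[of "1 - \<alpha>" u] assms by simp
  next
    case 3 then show ?thesis
      using convex_onD[OF powr_convex[OF assms(5)] assms(3,4), of u v] by simp
  qed
qed

section \<open>Monotonicity and continuity of the moments; sufficiency and necessity\<close>

context circle_measure
begin

lemma continuous_on_V_powr: "0 < a \<Longrightarrow> continuous_on (sphere 0 1) (\<lambda>z. V b z powr a)"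
  by (intro continuous_on_powr' continuous_intros) (auto intro: V_nonneg)

lemma A_minus: "0 < a \<Longrightarrow> A a (- b) = A a b"
  unfolding A_def by (rule reflect)

lemma A_abs: "0 < a \<Longrightarrow> A a \<bar>b\<bar> = A a b"
  using A_minus[of a b] by (simp add: abs_if)

lemma A_at_0: "A a 0 = 1"
  by (simp add: A_def V_def prob_space)

text \<open>1 + bz is a convex combination of 1 + b'z and 1 - b'z. The power 2a >= 1 of the norm is
  convex, and the moments at b' and -b' coincide. Hence only the extremal |r| has to be treated for
  sufficiency.\<close>

lemma A_mono:
  assumes a: "1 / 2 \<le> a" and "\<bar>b\<bar> \<le> \<bar>b'\<bar>"
  shows "A a b \<le> A a b'"
proof (cases "b' = 0")
  case True then show ?thesis using assms by simp
next
  case False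
  define \<kappa> where "\<kappa> = b / b'"
  have \<kappa>: "-1 \<le> \<kappa>" "\<kappa> \<le> 1" "b = \<kappa> * b'"
    using assms False by (auto simp: \<kappa>_def divide_simps split: if_splits)
  \<comment> \<open>Chosen so that (1 - \<alpha>) - \<alpha> = \<kappa>.\<close>
  define \<alpha> where "\<alpha> = (1 - \<kappa>) / 2"
  have \<alpha>: "0 \<le> \<alpha>" "\<alpha> \<le> 1" using \<kappa> by (auto simp: \<alpha>_def)
  have "V b z powr a \<le> (1 - \<alpha>) * V b' z powr a + \<alpha> * V (- b') z powr a" if z: "norm z = 1" for z
  proof -
    have W: "V x z powr a = norm (1 + complex_of_real x * z) powr (2 * a)" for x
      by (simp add: V_eq_norm[OF z] powr_powr flip: powr_numeral)
    have "1 + complex_of_real b * z = (1 - \<alpha>) *\<^sub>R (1 + complex_of_real b' * z) + \<alpha> *\<^sub>R (1 + complex_of_real (- b') * z)"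
      unfolding \<kappa>(3) \<alpha>_def by (simp add: scaleR_conv_of_real field_simps)
    then have "norm (1 + complex_of_real b * z) \<le> norm ((1 - \<alpha>) *\<^sub>R (1 + complex_of_real b' * z)) + norm (\<alpha> *\<^sub>R (1 + complex_of_real (- b') * z))"
      by (metis norm_triangle_ineq)
    also have "\<dots> = (1 - \<alpha>) * norm (1 + complex_of_real b' * z) + \<alpha> * norm (1 + complex_of_real (- b') * z)"
      using \<alpha> by (simp only: norm_scaleR abs_of_nonneg diff_ge_0_iff_ge)
    finally have "norm (1 + complex_of_real b * z) powr (2 * a) \<le> \<dots> powr (2 * a)"
      using a by (intro powr_mono2) auto
    also have "\<dots> \<le> (1 - \<alpha>) * norm (1 + complex_of_real b' * z) powr (2 * a) + \<alpha> * norm (1 + complex_of_real (- b') * z) powr (2 * a)"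
      using a \<alpha> by (intro powr_convex_nonneg) auto
    finally show ?thesis unfolding W .
  qed
  then have "A a b \<le> (\<integral>z. (1 - \<alpha>) * V b' z powr a + \<alpha> * V (- b') z powr a \<partial>M)"
    unfolding A_def using a
    by (intro integral_mono integrable_continuous continuous_intros continuous_on_V_powr) (auto simp: space_M)
  also have "\<dots> = (1 - \<alpha>) * A a b' + \<alpha> * A a (- b')"
    unfolding A_def using a by (simp add: integrable_continuous continuous_intros continuous_on_V_powr)
  also have "\<dots> = A a b'" using A_minus[of a b'] a by (simp add: algebra_simps)
  finally show ?thesis .
qed

lemma A_ge_1: "1 / 2 \<le> a \<Longrightarrow> 1 \<le> A a b"
  using A_mono[of a 0 b] by (simp add: A_at_0)

lemma A_inverse:
  assumes "0 < b"
  shows "A a b = b powr (2 * a) * A a (1 / b)"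
proof -
  have "V b z powr a = b powr (2 * a) * V (1 / b) z powr a" if z: "norm z = 1" for z
  proof -
    have "V b z = b\<^sup>2 * V (1 / b) z" using assms by (simp add: V_def power2_eq_square field_simps)
    then show ?thesis using V_nonneg[OF z, of "1 / b"] assms
      by (simp add: powr_mult powr_powr flip: powr_numeral)
  qed
  then show ?thesis
    unfolding A_def integral_mult_right_zero[symmetric]
    by (intro Bochner_Integration.integral_cong refl) (simp add: space_M)
qed

text \<open>Continuity reaches parameters of modulus 1, where V has a zero on the circle and
  \<open>A_curve_deriv\<close> does not apply. It lets the path from p to q cross b = 1.\<close>

lemma A_isCont:
  fixes e g :: "real \<Rightarrow> real"
  assumes e: "isCont e y0" and g: "isCont g y0" and pos: "0 < e y0"
  shows "isCont (\<lambda>y. A (e y) (g y)) y0"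
  unfolding isCont_def tendsto_at_iff_sequentially o_def
proof (intro allI impI)
  fix Y :: "nat \<Rightarrow> real"
  assume "\<forall>i. Y i \<in> UNIV - {y0}" and lim: "Y \<longlonglongrightarrow> y0"
  have le: "(\<lambda>n. e (Y n)) \<longlonglongrightarrow> e y0" "(\<lambda>n. g (Y n)) \<longlonglongrightarrow> g y0"
    using isCont_tendsto_compose[OF e lim] isCont_tendsto_compose[OF g lim] by auto
  have "eventually (\<lambda>n. 0 < e (Y n)) sequentially" "eventually (\<lambda>n. e (Y n) < e y0 + 1) sequentially"
    "eventually (\<lambda>n. \<bar>g (Y n)\<bar> < \<bar>g y0\<bar> + 1) sequentially"
    using order_tendstoD[OF le(1)] order_tendstoD[OF tendsto_rabs[OF le(2)]] pos by auto
  then have "eventually (\<lambda>n. 0 < e (Y n) \<and> e (Y n) < e y0 + 1 \<and> \<bar>g (Y n)\<bar> < \<bar>g y0\<bar> + 1) sequentially"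
    by eventually_elim auto
  then obtain N where N: "\<And>n. n \<ge> N \<Longrightarrow> 0 < e (Y n)" "\<And>n. n \<ge> N \<Longrightarrow> e (Y n) < e y0 + 1"
    "\<And>n. n \<ge> N \<Longrightarrow> \<bar>g (Y n)\<bar> < \<bar>g y0\<bar> + 1"
    unfolding eventually_sequentially by blast
  \<comment> \<open>Eventually 1 + |g| <= C, so V <= C^2. As C^2 >= 1, raising the exponent to e y0
    + 1 only enlarges the bound, which gives one constant majorant.\<close>
  define C where "C = 2 + \<bar>g y0\<bar>"
  have "(\<lambda>n. A (e (Y (n + N))) (g (Y (n + N)))) \<longlonglongrightarrow> A (e y0) (g y0)"
    unfolding A_def
  proof (rule integral_dominated_convergence[where w = "\<lambda>_. (C\<^sup>2) powr (e y0 + 1)"])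
    show "(\<lambda>z. V (g y0) z powr e y0) \<in> borel_measurable M"
      using pos by (intro meas_continuous continuous_on_V_powr)
    show "(\<lambda>z. V (g (Y (n + N))) z powr e (Y (n + N))) \<in> borel_measurable M" for n
      using N by (intro meas_continuous continuous_on_V_powr) auto
    show "AE z in M. (\<lambda>n. V (g (Y (n + N))) z powr e (Y (n + N))) \<longlonglongrightarrow> V (g y0) z powr e y0"
    proof (rule AE_I2)
      fix z assume "z \<in> space M"
      then have z: "norm z = 1" by (simp add: space_M)
      have "(\<lambda>n. V (g (Y n)) z powr e (Y n)) \<longlonglongrightarrow> V (g y0) z powr e y0"
        unfolding V_def[of "g (Y _)"] V_def[of "g y0"] using V_nonneg[OF z] pos
        by (intro tendsto_powr2 tendsto_intros le) (auto simp: V_def)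
      then show "(\<lambda>n. V (g (Y (n + N))) z powr e (Y (n + N))) \<longlonglongrightarrow> V (g y0) z powr e y0"
        by (rule LIMSEQ_ignore_initial_segment)
    qed
    show "AE z in M. norm (V (g (Y (n + N))) z powr e (Y (n + N))) \<le> (C\<^sup>2) powr (e y0 + 1)" for n
    proof (rule AE_I2)
      fix z assume "z \<in> space M"
      then have z: "norm z = 1" by (simp add: space_M)
      have C1: "1 \<le> C\<^sup>2" using one_le_power[of C 2] by (simp add: C_def)
      have "V (g (Y (n + N))) z \<le> (1 + \<bar>g (Y (n + N))\<bar>)\<^sup>2" by (rule V_bounds[OF z])
      also have "\<dots> \<le> C\<^sup>2" using N(3)[of "n + N"] by (intro power_mono) (auto simp: C_def)
      finally have "V (g (Y (n + N))) z powr e (Y (n + N)) \<le> (C\<^sup>2) powr e (Y (n + N))"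
        using N(1)[of "n + N"] V_nonneg[OF z] by (intro powr_mono2) auto
      also have "\<dots> \<le> (C\<^sup>2) powr (e y0 + 1)" using N(2)[of "n + N"] C1 by (intro powr_mono) auto
      finally show "norm (V (g (Y (n + N))) z powr e (Y (n + N))) \<le> (C\<^sup>2) powr (e y0 + 1)" by simp
    qed
  qed simp
  then show "(\<lambda>n. A (e (Y n)) (g (Y n))) \<longlonglongrightarrow> A (e y0) (g y0)"
    by (rule LIMSEQ_offset)
qed

text \<open>Along the curve b^2 (s + m) = x stays fixed. The derivative of the logarithm of the norm
  is nonpositive away from the one s where b = 1, and continuity joins the two sides.\<close>

lemma ln_A_over_s_mono:
  assumes x: "0 < x" and p: "4 \<le> p" "p \<le> q"
  shows "ln (A (q / 2) (sqrt (x / (q + m)))) / q \<le> ln (A (p / 2) (sqrt (x / (p + m)))) / p"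
proof -
  define \<beta> where "\<beta> s = sqrt (x / (s + m))" for s
  define \<Phi> where "\<Phi> s = ln (A (s / 2) (\<beta> s)) / s" for s
  have sm: "0 < s + m" if "4 \<le> s" for s using that m_ge by simp
  have Ap: "0 < A (s / 2) b" if "4 \<le> s" for s b using A_ge_1[of "s / 2" b] that by simp
  have \<beta>': "(\<beta> has_real_derivative - \<beta> s / (2 * (s + m))) (at s)" if "3 < s" for s
  proof -
    have s: "0 < s + m" using that m_ge by simp
    have "(\<beta> has_real_derivative (inverse (sqrt (x / (s + m))) / 2) * (- x / (s + m)\<^sup>2)) (at s)"
      unfolding \<beta>_def using s divide_pos_pos[OF x s] by (auto intro!: derivative_eq_intros simp: power2_eq_square)
    also have "(inverse (sqrt (x / (s + m))) / 2) * (- x / (s + m)\<^sup>2) = - (inverse (\<beta> s) * (x / (s + m))) / (2 * (s + m))"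
      unfolding \<beta>_def power2_eq_square by simp
    also have "x / (s + m) = \<beta> s * \<beta> s" using s x by (simp add: \<beta>_def)
    also have "inverse (\<beta> s) * (\<beta> s * \<beta> s) = \<beta> s" by (cases "\<beta> s = 0") (simp_all add: mult.assoc[symmetric])
    finally show ?thesis .
  qed
  have \<beta>pos: "0 < \<beta> s" if "3 < s" for s using that x m_ge by (simp add: \<beta>_def)
  \<comment> \<open>Here -\<beta> / (2 (s + m)) is the speed of the parameter, and the derivative is
    nonpositive precisely by \<open>log_Sobolev\<close> at a = s / 2.\<close>
  have small: "\<exists>y. (\<Phi> has_real_derivative y) (at s) \<and> y \<le> 0" if s: "4 < s" "\<beta> s < 1" for s
  proof -
    define a c \<delta> where "a = s / 2" and "c = s + m" and "\<delta> = 1 - (\<beta> s)\<^sup>2"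
    have b: "0 < \<beta> s" "\<beta> s < 1" "\<bar>\<beta> s\<bar> < 1" using s \<beta>pos[of s] by auto
    have c: "0 < c" "c = m + 2 * a" using sm[of s] s by (auto simp: c_def a_def)
    have cont: "continuous_on {3<..<s+1} \<beta>"
      by (intro continuous_at_imp_continuous_on ballI DERIV_isCont[OF \<beta>']) auto
    define I where "I = (\<integral>z. V (\<beta> s) z powr (s / 2 - 1) * (2 * \<beta> s + 2 * Re z) \<partial>M)"
    have bI: "\<beta> s * I = A a (\<beta> s) - \<delta> * A (a - 1) (\<beta> s)"
      unfolding I_def a_def \<delta>_def by (rule b_times_A_deriv[OF b(3)])
    have lt1: "\<bar>\<beta> y\<bar> < 1" if "x - m < y" "3 < y" for y
      using that x m_ge by (simp add: \<beta>_def)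
    have xs: "x - m < s" using s(2) c(1) by (simp add: \<beta>_def c_def)
    have dA: "((\<lambda>y. A (y / 2) (\<beta> y)) has_real_derivative 1 / 2 * B (s / 2) (\<beta> s) + s / 2 * (- \<beta> s / (2 * (s + m))) * I) (at s)"
      unfolding I_def
    proof (rule A_curve_deriv[where l = "max 3 (x - m)" and h = "s + 1" and e = "\<lambda>y. y / 2" and e' = "\<lambda>_. 1 / 2" and g = \<beta> and g' = "\<lambda>s. - \<beta> s / (2 * (s + m))"])
      show "continuous_on {max 3 (x - m)<..<s + 1} (\<lambda>s. - \<beta> s / (2 * (s + m)))"
        using m_ge by (intro continuous_intros continuous_on_subset[OF cont]) auto
    qed (use s xs lt1 \<beta>' in \<open>auto intro!: derivative_eq_intros\<close>)
    have e1: "1 / 2 * B (s / 2) (\<beta> s) + s / 2 * (- \<beta> s / (2 * (s + m))) * I = (B a (\<beta> s) - a / c * (A a (\<beta> s) - \<delta> * A (a - 1) (\<beta> s))) / 2"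
      unfolding bI[symmetric] c_def[symmetric] using c(1) by (simp add: a_def field_simps)
    have ls: "a * B a (\<beta> s) - A a (\<beta> s) * ln (A a (\<beta> s)) \<le> a\<^sup>2 / c * (A a (\<beta> s) - \<delta> * A (a - 1) (\<beta> s))"
      unfolding c(2) \<delta>_def by (rule log_Sobolev) (use b s in \<open>auto simp: a_def\<close>)
    have ap: "0 < a" using s by (simp add: a_def)
    have "a * (B a (\<beta> s) - a / c * (A a (\<beta> s) - \<delta> * A (a - 1) (\<beta> s))) \<le> A a (\<beta> s) * ln (A a (\<beta> s))"
      using ls by (simp add: power2_eq_square right_diff_distrib)
    then have le: "(B a (\<beta> s) - a / c * (A a (\<beta> s) - \<delta> * A (a - 1) (\<beta> s))) / 2 \<le> A a (\<beta> s) * ln (A a (\<beta> s)) / s"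
      using ap by (simp add: a_def field_simps)
    have Aps: "0 < A (s / 2) (\<beta> s)" using Ap s by simp
    have "(\<Phi> has_real_derivative ((1 / 2 * B (s / 2) (\<beta> s) + s / 2 * (- \<beta> s / (2 * (s + m))) * I) / A (s / 2) (\<beta> s) * s - ln (A (s / 2) (\<beta> s))) / (s * s)) (at s)"
      unfolding \<Phi>_def using Aps s by (auto intro!: derivative_eq_intros dA)
    moreover have "((1 / 2 * B (s / 2) (\<beta> s) + s / 2 * (- \<beta> s / (2 * (s + m))) * I) / A (s / 2) (\<beta> s) * s - ln (A (s / 2) (\<beta> s))) / (s * s) \<le> 0"
      unfolding e1 using le Aps s by (simp add: divide_le_0_iff a_def) (simp add: field_simps)
    ultimately show ?thesis by blast
  qed
  \<comment> \<open>The reciprocal parameter \<open>g\<close> increases with s, so the term (a / c)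
    T enters with the opposite sign and is paid for by the derivative of ln \<beta>, which comes
    from the factor b^s in \<open>A_inverse\<close>.\<close>
  have large: "\<exists>y. (\<Phi> has_real_derivative y) (at s) \<and> y \<le> 0" if s: "4 < s" "1 < \<beta> s" for s
  proof -
    define g where "g y = 1 / \<beta> y" for y
    define a c \<delta> where "a = s / 2" and "c = s + m" and "\<delta> = 1 - (g s)\<^sup>2"
    have b: "0 < g s" "g s < 1" "\<bar>g s\<bar> < 1" using s by (auto simp: g_def)
    have c: "0 < c" "c = m + 2 * a" using sm[of s] s by (auto simp: c_def a_def)
    have g': "(g has_real_derivative g y / (2 * (y + m))) (at y)" if "3 < y" for y
    proof -
      have "(g has_real_derivative (0 * \<beta> y - 1 * (- \<beta> y / (2 * (y + m)))) / (\<beta> y * \<beta> y)) (at y)"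
        unfolding g_def using \<beta>pos[OF that] by (intro DERIV_divide DERIV_const \<beta>' that) auto
      also have "(0 * \<beta> y - 1 * (- \<beta> y / (2 * (y + m)))) / (\<beta> y * \<beta> y) = g y / (2 * (y + m))"
        using \<beta>pos[OF that] by (simp add: g_def)
      finally show ?thesis .
    qed
    have cont: "continuous_on {3<..<x - m} g"
      by (intro continuous_at_imp_continuous_on ballI DERIV_isCont[OF g']) auto
    define I where "I = (\<integral>z. V (g s) z powr (s / 2 - 1) * (2 * g s + 2 * Re z) \<partial>M)"
    have bI: "g s * I = A a (g s) - \<delta> * A (a - 1) (g s)"
      unfolding I_def a_def \<delta>_def by (rule b_times_A_deriv[OF b(3)])
    have lt1: "\<bar>g y\<bar> < 1" if "y < x - m" "3 < y" for y
      using that x m_ge by (simp add: \<beta>_def g_def)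
    have xs: "s < x - m" using s(2) c(1) by (simp add: \<beta>_def c_def)
    have dA: "((\<lambda>y. A (y / 2) (g y)) has_real_derivative 1 / 2 * B (s / 2) (g s) + s / 2 * (g s / (2 * (s + m))) * I) (at s)"
      unfolding I_def
    proof (rule A_curve_deriv[where l = 3 and h = "x - m" and e = "\<lambda>y. y / 2" and e' = "\<lambda>_. 1 / 2" and g = g and g' = "\<lambda>s. g s / (2 * (s + m))"])
      show "continuous_on {3<..<x - m} (\<lambda>s. g s / (2 * (s + m)))"
        using m_ge by (intro continuous_intros cont) auto
    qed (use s xs lt1 g' in \<open>auto intro!: derivative_eq_intros\<close>)
    define T where "T = A a (g s) - \<delta> * A (a - 1) (g s)"
    have e1: "1 / 2 * B (s / 2) (g s) + s / 2 * (g s / (2 * (s + m))) * I = (B a (g s) + a / c * T) / 2"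
      unfolding T_def bI[symmetric] c_def[symmetric] using c(1) by (simp add: a_def field_simps)
    have ls: "a * B a (g s) - A a (g s) * ln (A a (g s)) \<le> a\<^sup>2 / c * T"
      unfolding c(2) \<delta>_def T_def by (rule log_Sobolev) (use b s in \<open>auto simp: a_def\<close>)
    have ap: "0 < a" using s by (simp add: a_def)
    have Aps: "0 < A a (g s)" using Ap s by (simp add: a_def)
    have "0 < \<delta>" using b by (simp add: \<delta>_def power_less_one_iff)
    then have T: "T \<le> A a (g s)" using A_pos[OF b(3), of "a - 1"] by (simp add: T_def)
    have "a * (B a (g s) + a / c * T) = a * B a (g s) + a\<^sup>2 / c * T"
      by (simp add: power2_eq_square distrib_left)
    also have "\<dots> \<le> A a (g s) * ln (A a (g s)) + 2 * (a\<^sup>2 / c * T)"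
    proof -
      have "u + w \<le> v + 2 * w" if "u - v \<le> w" for u v w :: real using that by simp
      from this[OF ls] show ?thesis .
    qed
    finally have "a * (B a (g s) + a / c * T) \<le> A a (g s) * ln (A a (g s)) + 2 * (a\<^sup>2 / c * T)" .
    also have "\<dots> \<le> A a (g s) * ln (A a (g s)) + 2 * (a\<^sup>2 / c * A a (g s))"
      using T c(1) by (intro add_left_mono mult_left_mono) auto
    finally have "(B a (g s) + a / c * T) / 2 / A a (g s) * s \<le> ln (A a (g s)) + 2 * (a\<^sup>2 / c)"
      using Aps by (simp add: a_def field_simps)
    then have le: "((B a (g s) + a / c * T) / 2 / A a (g s) * s - ln (A a (g s))) / (s * s) \<le> 2 * (a\<^sup>2 / c) / (s * s)"
      by (intro divide_right_mono) auto
    have \<Phi>: "\<Phi> y = ln (\<beta> y) + ln (A (y / 2) (g y)) / y" if "4 < y" for y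
    proof -
      have "A (y / 2) (\<beta> y) = \<beta> y powr y * A (y / 2) (g y)"
        using A_inverse[OF \<beta>pos, of y "y / 2"] that by (simp add: g_def)
      then show ?thesis
        using Ap[of y "g y"] \<beta>pos[of y] that by (simp add: \<Phi>_def ln_mult add_divide_distrib)
    qed
    let ?d = "- 1 / (2 * c) + ((1 / 2 * B (s / 2) (g s) + s / 2 * (g s / (2 * (s + m))) * I) / A (s / 2) (g s) * s - ln (A (s / 2) (g s))) / (s * s)"
    have "((\<lambda>y. ln (\<beta> y)) has_real_derivative - 1 / (2 * c)) (at s)"
      using \<beta>pos[of s] s c by (auto intro!: derivative_eq_intros \<beta>' simp: c_def)
    moreover have "((\<lambda>y. ln (A (y / 2) (g y)) / y) has_real_derivative ((1 / 2 * B (s / 2) (g s) + s / 2 * (g s / (2 * (s + m))) * I) / A (s / 2) (g s) * s - ln (A (s / 2) (g s))) / (s * s)) (at s)"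
      using Aps s by (auto intro!: derivative_eq_intros dA simp: a_def)
    ultimately have "((\<lambda>y. ln (\<beta> y) + ln (A (y / 2) (g y)) / y) has_real_derivative ?d) (at s)"
      by (rule DERIV_add)
    then have "(\<Phi> has_real_derivative ?d) (at s)"
      by (rule has_field_derivative_transform_within_open[of _ _ _ "{4<..}"]) (use s \<Phi> in auto)
    moreover have "?d \<le> 0"
    proof -
      \<comment> \<open>As s = 2a, the excess from counting T twice, bounded through T <= A, cancels
        the derivative -1 / (2c) of ln \<beta> exactly.\<close>
      have "2 * (a\<^sup>2 / c) / (s * s) = 1 / (2 * c)" using s c(1) by (simp add: a_def power2_eq_square)
      then show ?thesis using le unfolding e1 by (simp add: a_def)
    qed
    ultimately show ?thesis by blast
  qed
  have cont: "continuous_on {p..q} \<Phi>"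
  proof (intro continuous_at_imp_continuous_on ballI)
    fix s assume s: "s \<in> {p..q}"
    have "isCont (\<lambda>s. A (s / 2) (\<beta> s)) s"
      using s p by (intro A_isCont DERIV_isCont[OF \<beta>']) (auto intro!: continuous_intros)
    then show "isCont \<Phi> s" unfolding \<Phi>_def using Ap[of s "\<beta> s"] s p by (intro continuous_intros) auto
  qed
  \<comment> \<open>\<beta> s = 1 happens only at s = x - m, where no derivative is at hand; the
    interval is split there if necessary.\<close>
  have part: "\<Phi> v \<le> \<Phi> u" if "p \<le> u" "u \<le> v" "v \<le> q" "\<And>s. u < s \<Longrightarrow> s < v \<Longrightarrow> s \<noteq> x - m" for u v
  proof (rule DERIV_nonpos_imp_decreasing_open[OF that(2)])
    fix s assume s: "u < s" "s < v"
    have "s \<noteq> x - m" "4 < s" using that(4)[OF s] s that p by auto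
    then have "\<beta> s \<noteq> 1" using x sm[of s] by (auto simp: \<beta>_def)
    then show "\<exists>y. (\<Phi> has_real_derivative y) (at s) \<and> y \<le> 0"
      using small[of s] large[of s] \<open>4 < s\<close> by (cases "\<beta> s < 1") auto
  qed (use that in \<open>auto intro: continuous_on_subset[OF cont]\<close>)
  have "\<Phi> q \<le> \<Phi> p"
  proof (cases "p < x - m \<and> x - m < q")
    case True
    then have "\<Phi> q \<le> \<Phi> (x - m)" "\<Phi> (x - m) \<le> \<Phi> p" by (intro part; auto)+
    then show ?thesis by linarith
  next
    case False
    then show ?thesis using p by (intro part) auto
  qed
  then show ?thesis by (simp add: \<Phi>_def \<beta>_def)
qed

lemma hypercontractive:
  assumes p: "4 \<le> p" "p \<le> q" and r: "\<bar>r\<bar> \<le> sqrt ((p + m) / (q + m))"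
  shows "A (q / 2) (r * b) powr (1 / q) \<le> A (p / 2) b powr (1 / p)"
proof (cases "b = 0")
  case True then show ?thesis by (simp add: A_at_0)
next
  case False
  define r0 where "r0 = sqrt ((p + m) / (q + m))"
  \<comment> \<open>The curve then passes through |b| at s = p and through r0 |b| at s = q.\<close>
  define x where "x = b\<^sup>2 * (p + m)"
  have pm: "0 < p + m" "0 < q + m" using p m_ge by auto
  have x: "0 < x" using False pm by (simp add: x_def)
  have b1: "sqrt (x / (p + m)) = \<bar>b\<bar>" using pm by (simp add: x_def)
  have b2: "sqrt (x / (q + m)) = r0 * \<bar>b\<bar>" by (simp add: x_def r0_def real_sqrt_mult real_sqrt_divide)
  have A1: "1 \<le> A (q / 2) y" "1 \<le> A (p / 2) y" for y using A_ge_1 p by auto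
  have "\<bar>r * b\<bar> \<le> \<bar>r0 * \<bar>b\<bar>\<bar>"
    using r by (simp add: abs_mult r0_def[symmetric] mult_right_mono)
  then have "A (q / 2) (r * b) \<le> A (q / 2) (r0 * \<bar>b\<bar>)" using p by (intro A_mono) auto
  then have "A (q / 2) (r * b) powr (1 / q) \<le> A (q / 2) (r0 * \<bar>b\<bar>) powr (1 / q)"
    using A1(1)[of "r * b"] p by (intro powr_mono2) auto
  also have "\<dots> = exp (ln (A (q / 2) (r0 * \<bar>b\<bar>)) / q)"
    using A1(1)[of "r0 * \<bar>b\<bar>"] by (simp add: powr_def)
  also have "\<dots> \<le> exp (ln (A (p / 2) \<bar>b\<bar>) / p)"
    using ln_A_over_s_mono[OF x p] unfolding b1 b2 by simp
  also have "\<dots> = A (p / 2) \<bar>b\<bar> powr (1 / p)"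
    using A1(2)[of "\<bar>b\<bar>"] by (simp add: powr_def)
  also have "A (p / 2) \<bar>b\<bar> = A (p / 2) b" using p by (intro A_abs) auto
  finally show ?thesis .
qed

text \<open>By \<open>A_ratio_expansion\<close>, (1/s) ln A_(s/2)(b) = (s + m) b^2 / (2 (m + 2)) up
  to higher order, so r^2 (q + m) > p + m would violate the inequality for small b.\<close>

lemma hypercontractive_necessary:
  assumes pq: "1 \<le> p" "1 \<le> q" "0 < p + m" "0 < q + m"
    and le: "\<And>b. A (q / 2) (r * b) powr (1 / q) \<le> A (p / 2) b powr (1 / p)"
  shows "\<bar>r\<bar> \<le> sqrt ((p + m) / (q + m))"
proof (rule ccontr)
  assume neg: "\<not> \<bar>r\<bar> \<le> sqrt ((p + m) / (q + m))"
  \<comment> \<open>Passing to |r|, which the symmetry of the moments allows, keeps the argument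
    \<rho> b inside (0, 1), where the derivative formulas hold.\<close>
  define \<rho> where "\<rho> = \<bar>r\<bar>"
  have "0 \<le> sqrt ((p + m) / (q + m))" using pq by simp
  then have \<rho>: "0 < \<rho>" using neg unfolding \<rho>_def by linarith
  have "(p + m) / (q + m) < \<rho>\<^sup>2"
  proof (rule ccontr)
    assume "\<not> (p + m) / (q + m) < \<rho>\<^sup>2"
    then have "sqrt (\<rho>\<^sup>2) \<le> sqrt ((p + m) / (q + m))" by (simp only: real_sqrt_le_iff not_less)
    then show False using neg by (simp add: \<rho>_def)
  qed
  then have gap: "0 < \<rho>\<^sup>2 * (q + m) - (p + m)" using pq by (simp add: field_simps)
  have Apos: "0 < A (q / 2) y" "0 < A (p / 2) y" for y
    using A_ge_1[of "q / 2" y] A_ge_1[of "p / 2" y] pq by auto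
  define f where "f b = ln (A (q / 2) (\<rho> * b)) / q - ln (A (p / 2) b) / p" for b
  have f_le: "f b \<le> 0" for b
  proof -
    have "A (q / 2) (\<rho> * b) = A (q / 2) (r * b)"
      using A_minus[of "q / 2" "r * b"] pq by (simp add: \<rho>_def abs_if)
    then have "A (q / 2) (\<rho> * b) powr (1 / q) \<le> A (p / 2) b powr (1 / p)" using le by simp
    then have "ln (A (q / 2) (\<rho> * b) powr (1 / q)) \<le> ln (A (p / 2) b powr (1 / p))"
      using Apos[of "\<rho> * b"] by (subst ln_le_cancel_iff) (auto simp: less_imp_neq[THEN not_sym] Apos)
    then show ?thesis using Apos by (simp add: f_def ln_powr)
  qed
  define X where "X a b = (1 - 1 / A_ratio a b) / b\<^sup>2" for a b
  \<comment> \<open>The limit of f' b / b at 0. Close to 0 therefore f' b > (\<eta> / 2) b, and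
    integration gives f b >= (\<eta> / 4) b^2, against f <= 0.\<close>
  define \<eta> where "\<eta> = (\<rho>\<^sup>2 * (q + m) - (p + m)) / (m + 2)"
  have \<eta>: "0 < \<eta>" using gap m_ge by (simp add: \<eta>_def)
  have f': "(f has_real_derivative (\<rho>\<^sup>2 * X (q / 2) (\<rho> * b) - X (p / 2) b) / 2 * b) (at b)" if b: "0 < b" "b < 1" "\<rho> * b < 1" for b
  proof -
    have "((\<lambda>b. ln (A (q / 2) (\<rho> * b))) has_real_derivative q / 2 * (1 - 1 / A_ratio (q / 2) (\<rho> * b)) / (\<rho> * b) * \<rho>) (at b)"
      by (rule DERIV_chain2[OF ln_A_deriv]) (use b \<rho> in \<open>auto intro!: derivative_eq_intros\<close>)
    moreover have "((\<lambda>b. ln (A (p / 2) b)) has_real_derivative p / 2 * (1 - 1 / A_ratio (p / 2) b) / b) (at b)"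
      by (rule ln_A_deriv) (use b in auto)
    ultimately have "(f has_real_derivative q / 2 * (1 - 1 / A_ratio (q / 2) (\<rho> * b)) / (\<rho> * b) * \<rho> / q - p / 2 * (1 - 1 / A_ratio (p / 2) b) / b / p) (at b)"
      unfolding f_def by (intro DERIV_diff DERIV_cdivide)
    also have "q / 2 * (1 - 1 / A_ratio (q / 2) (\<rho> * b)) / (\<rho> * b) * \<rho> / q - p / 2 * (1 - 1 / A_ratio (p / 2) b) / b / p
      = (\<rho>\<^sup>2 * X (q / 2) (\<rho> * b) - X (p / 2) b) / 2 * b"
    proof -
      have "q / 2 * U / (\<rho> * b) * \<rho> / q - p / 2 * W / b / p = (\<rho>\<^sup>2 * (U / (\<rho> * b)\<^sup>2) - W / b\<^sup>2) / 2 * b" for U W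
        using b \<rho> pq by (simp add: power2_eq_square field_simps)
      then show ?thesis unfolding X_def .
    qed
    finally show ?thesis .
  qed
  have at: "filterlim (\<lambda>b. \<rho> * b) (at_right 0) (at_right 0)"
  proof (rule filterlim_at_withinI)
    show "((\<lambda>b. \<rho> * b) \<longlongrightarrow> 0) (at_right 0)" using tendsto_mult_right_zero[of "\<lambda>b. b" "at_right 0" \<rho>] by (simp add: tendsto_ident_at)
    show "\<forall>\<^sub>F b in at_right 0. \<rho> * b \<in> {0<..} - {0}"
      using \<rho> by (auto simp: eventually_at_right_field intro!: exI[of _ 1])
  qed
  have "((\<lambda>b. (\<rho>\<^sup>2 * X (q / 2) (\<rho> * b) - X (p / 2) b) / 2) \<longlongrightarrow> (\<rho>\<^sup>2 * (2 * (m + 2 * (q / 2)) / (m + 2)) - 2 * (m + 2 * (p / 2)) / (m + 2)) / 2) (at_right 0)"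
    unfolding X_def by (intro tendsto_intros A_ratio_expansion filterlim_compose[OF A_ratio_expansion at]) simp
  also have "(\<rho>\<^sup>2 * (2 * (m + 2 * (q / 2)) / (m + 2)) - 2 * (m + 2 * (p / 2)) / (m + 2)) / 2 = \<eta>"
    using m_ge unfolding \<eta>_def by (simp add: divide_simps) (simp add: algebra_simps)
  finally have lim: "((\<lambda>b. (\<rho>\<^sup>2 * X (q / 2) (\<rho> * b) - X (p / 2) b) / 2) \<longlongrightarrow> \<eta>) (at_right 0)" .
  have "eventually (\<lambda>b. \<eta> / 2 < (\<rho>\<^sup>2 * X (q / 2) (\<rho> * b) - X (p / 2) b) / 2) (at_right 0)"
    by (rule order_tendstoD(1)[OF lim]) (use \<eta> in simp)
  then obtain h where h: "0 < h" "\<And>b. 0 < b \<Longrightarrow> b < h \<Longrightarrow> \<eta> / 2 < (\<rho>\<^sup>2 * X (q / 2) (\<rho> * b) - X (p / 2) b) / 2"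
    unfolding eventually_at_right_field by auto
  define h' where "h' = min h (min 1 (1 / \<rho>))"
  have h': "0 < h'" "\<And>b. b < h' \<Longrightarrow> b < h \<and> b < 1 \<and> \<rho> * b < 1"
    using h(1) \<rho> by (auto simp: h'_def field_simps)
  have "0 \<le> f (h' / 2) - \<eta> / 4 * (h' / 2)\<^sup>2"
  proof (rule nonneg_if_DERIV_nonneg_where_negative[where f = "\<lambda>b. f b - \<eta> / 4 * b\<^sup>2" and h = h' and
      f' = "\<lambda>b. (\<rho>\<^sup>2 * X (q / 2) (\<rho> * b) - X (p / 2) b) / 2 * b - \<eta> / 2 * b"])
    fix b assume b: "0 < b" "b < h'"
    note hb = h'(2)[OF b(2)]
    have "((\<lambda>b. \<eta> / 4 * b\<^sup>2) has_real_derivative \<eta> / 2 * b) (at b)"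
      by (auto intro!: derivative_eq_intros)
    then show "((\<lambda>b. f b - \<eta> / 4 * b\<^sup>2) has_real_derivative (\<rho>\<^sup>2 * X (q / 2) (\<rho> * b) - X (p / 2) b) / 2 * b - \<eta> / 2 * b) (at b)"
      using b hb by (intro DERIV_diff f') auto
    show "0 \<le> (\<rho>\<^sup>2 * X (q / 2) (\<rho> * b) - X (p / 2) b) / 2 * b - \<eta> / 2 * b"
      using mult_right_mono[OF less_imp_le[OF h(2)[of b]], of b] b hb by simp
  next
    have "isCont (A a) 0" for a using DERIV_isCont[OF A_deriv_0] .
    then have "isCont (\<lambda>b. f b - \<eta> / 4 * b\<^sup>2) 0"
      unfolding f_def using pq A_at_0
      by (intro continuous_intros isCont_o2[where g = "A _" and f = "\<lambda>b. \<rho> * b"]) (auto simp: A_at_0)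
    moreover have "f 0 = 0" by (simp add: f_def A_at_0)
    ultimately have "((\<lambda>b. f b - \<eta> / 4 * b\<^sup>2) \<longlongrightarrow> 0) (at 0)" by (simp add: isCont_def)
    then show "((\<lambda>b. f b - \<eta> / 4 * b\<^sup>2) \<longlongrightarrow> 0) (at_right 0)" by (rule filterlim_mono) (auto intro: at_le)
  qed (use h' in auto)
  moreover have "0 < \<eta> / 4 * (h' / 2)\<^sup>2" using \<eta> h' by simp
  ultimately show False using f_le[of "h' / 2"] by linarith
qed

end

subsection \<open>The ultraspherical measures\<close>

lemma borel_measurable_V [measurable]: "V b \<in> borel_measurable borel"
  unfolding V_def by measurable

lemma borel_measurable_borel_circle:
  "f \<in> borel_measurable borel \<Longrightarrow> f \<in> borel_measurable borel_circle" for f :: "complex \<Rightarrow> real"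
  by (rule measurable_restrict_space1)

text \<open>Stein's identity reads 0 = 0: m + 1 vanishes on the left, and 1 - x^2 vanishes at both
  atoms on the right.\<close>

lemma circle_measure_minus_one: "circle_measure (ultraspherical (-1)) (-1)"
proof -
  let ?M = "ultraspherical (-1)"
  have id: "(\<lambda>z. z) \<in> measurable (uniform_count_measure {-1, 1 :: complex}) borel_circle"
    by (auto simp: measurable_def space_restrict_space space_uniform_count_measure sets_uniform_count_measure)
  have int: "(\<integral>z. f z \<partial>?M) = (f (-1) + f 1) / 2" if "f \<in> borel_measurable borel" for f :: "complex \<Rightarrow> real"
    unfolding ultraspherical_def using borel_measurable_borel_circle[OF that] id
    by (simp add: integral_distr integral_uniform_count_measure)
  interpret prob_space ?M
    unfolding ultraspherical_def using prob_space.prob_space_distr[OF prob_space_uniform_count_measure id] by simp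
  show ?thesis
  proof
    fix a b :: real
    show "(- 1 + 1) * (\<integral>z. Re z * V b z powr a \<partial>?M) = 2 * a * b * (\<integral>z. (1 - (Re z)\<^sup>2) * V b z powr (a - 1) \<partial>?M)"
      by (subst int) simp_all
    show "(\<integral>z. V (- b) z powr a \<partial>?M) = (\<integral>z. V b z powr a \<partial>?M)"
      by (subst int, measurable)+ (simp add: V_def)
  qed simp_all
qed

text \<open>Substituting u = (sin t)^2 turns the Beta integrand u^((m-1)/2) (1 - u)^(-1/2) du into 2
  (sin t)^m dt.\<close>

lemma nn_integral_sin_powr_half:
  assumes m: "-1 < m"
  shows "(\<integral>\<^sup>+t. ennreal (sin t powr m * indicator {0..pi/2} t) \<partial>lborel) = ennreal (Beta ((m + 1) / 2) (1 / 2) / 2)"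
proof -
  let ?f = "\<lambda>t::real. t powr ((m + 1) / 2 - 1) * (1 - t) powr (1 / 2 - 1)"
  have "(?f has_integral Beta ((m + 1) / 2) (1 / 2)) {0..1}"
    using m by (intro has_integral_Beta_real) auto
  from nn_integral_has_integral_lebesgue[OF _ this]
  have "ennreal (Beta ((m + 1) / 2) (1 / 2)) = (\<integral>\<^sup>+t. ennreal (?f t * indicator {(sin 0)\<^sup>2..(sin (pi / 2))\<^sup>2} t) \<partial>lborel)"
    by (simp add: mult.commute)
  also have "\<dots> = (\<integral>\<^sup>+t. ennreal (?f ((sin t)\<^sup>2) * (2 * sin t * cos t) * indicator {0..pi/2} t) \<partial>lborel)"
    by (rule nn_integral_substitution)
       (auto intro!: derivative_eq_intros continuous_intros mult_nonneg_nonneg sin_ge_zero cos_ge_zero simp: set_borel_measurable_def)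
  also have "\<dots> = (\<integral>\<^sup>+t. 2 * ennreal (sin t powr m * indicator {0..pi/2} t) \<partial>lborel)"
  \<comment> \<open>At pi/2 the left integrand is 0 because of the factor cos t, while the right one
    is 2; equality holds only almost everywhere.\<close>
  proof (intro nn_integral_cong_AE AE_I[of _ _ "{0, pi / 2}"])
    show "{t \<in> space lborel. ennreal (?f ((sin t)\<^sup>2) * (2 * sin t * cos t) * indicator {0..pi/2} t)
        \<noteq> 2 * ennreal (sin t powr m * indicator {0..pi/2} t)} \<subseteq> {0, pi / 2}"
    proof (rule ccontr)
      assume "\<not> ?thesis"
      then obtain t where ne: "t \<noteq> 0" "t \<noteq> pi / 2"
        "ennreal (?f ((sin t)\<^sup>2) * (2 * sin t * cos t) * indicator {0..pi/2} t) \<noteq> 2 * ennreal (sin t powr m * indicator {0..pi/2} t)"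
        by blast
      have "t \<in> {0..pi / 2}" using ne(3) by (rule contrapos_np) simp
      then have t: "0 < t" "t < pi / 2" using ne(1,2) by auto
      have sc: "0 < sin t" "0 < cos t" using t by (auto intro: sin_gt_zero cos_gt_zero)
      have "(sin t)\<^sup>2 powr x = sin t powr (2 * x)" for x
        using sc by (simp add: powr_powr flip: powr_numeral)
      moreover have "2 * ((m + 1) / 2 - 1) = m - 1" by (simp add: field_simps)
      ultimately have "(sin t)\<^sup>2 powr ((m + 1) / 2 - 1) = sin t powr (m - 1)" by (simp only:)
      moreover have "(1 - (sin t)\<^sup>2) powr (1 / 2 - 1) = cos t powr (- 1)"
        unfolding cos_squared_eq[symmetric] using sc by (simp add: powr_powr flip: powr_numeral)
      ultimately have eq: "?f ((sin t)\<^sup>2) * (2 * sin t * cos t) = 2 * sin t powr m"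
        using sc by (simp add: powr_diff powr_minus_divide)
      show False using ne(3) unfolding eq using t by (simp add: ennreal_mult')
    qed
  qed (auto simp: emeasure_lborel_countable)
  also have "\<dots> = 2 * (\<integral>\<^sup>+t. ennreal (sin t powr m * indicator {0..pi/2} t) \<partial>lborel)"
    by (rule nn_integral_cmult) measurable
  finally have "2 * (\<integral>\<^sup>+t. ennreal (sin t powr m * indicator {0..pi/2} t) \<partial>lborel) = 2 * ennreal (Beta ((m + 1) / 2) (1 / 2) / 2)"
    by (simp add: ennreal_mult'[symmetric] flip: ennreal_numeral)
  then show ?thesis by (simp add: ennreal_mult_cancel_left)
qed

lemma nn_integral_lborel_reflect:
  fixes f :: "real \<Rightarrow> ennreal"
  assumes "f \<in> borel_measurable borel"
  shows "(\<integral>\<^sup>+t. f (c - t) \<partial>lborel) = (\<integral>\<^sup>+t. f t \<partial>lborel)"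
  using nn_integral_real_affine[OF assms, of "-1" c] by simp

lemma integral_lborel_reflect:
  fixes f :: "real \<Rightarrow> real"
  shows "(\<integral>t. f (c - t) \<partial>lborel) = (\<integral>t. f t \<partial>lborel)"
  using lborel_integral_real_affine[of "-1" f c] by simp

lemma le_pi_imp_less_2pi: "x \<le> pi \<Longrightarrow> x < 2 * pi"
  using pi_gt_zero by linarith

text \<open>Four copies of the quarter period, matched by t -> pi - t and t -> 2 pi - t. Working
  with nonnegative integrals postpones integrability, which matters since the weight is unbounded
  for m < 0.\<close>

lemma nn_integral_abs_sin_powr:
  assumes m: "-1 < m"
  shows "(\<integral>\<^sup>+t. ennreal (\<bar>sin t\<bar> powr m * indicator {0..<2 * pi} t) \<partial>lborel) = ennreal (2 * Beta ((m + 1) / 2) (1 / 2))"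
proof -
  let ?h = "\<lambda>S t. ennreal (\<bar>sin t\<bar> powr m * indicator S t)"
  have meas: "?h S \<in> borel_measurable borel" if "S \<in> sets borel" for S
    using that by measurable
  have split: "(\<integral>\<^sup>+t. ?h (S \<union> T) t \<partial>lborel) = (\<integral>\<^sup>+t. ?h S t \<partial>lborel) + (\<integral>\<^sup>+t. ?h T t \<partial>lborel)"
    if "S \<inter> T = {}" "S \<in> sets borel" "T \<in> sets borel" for S T
    using that meas
    by (subst nn_integral_add[symmetric]) (auto intro!: nn_integral_cong simp: indicator_def)
  have "(\<integral>\<^sup>+t. ?h {0..pi/2} t \<partial>lborel) = (\<integral>\<^sup>+t. ennreal (sin t powr m * indicator {0..pi/2} t) \<partial>lborel)"
    by (intro nn_integral_cong) (auto simp: indicator_def sin_ge_zero)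
  then have 1: "(\<integral>\<^sup>+t. ?h {0..pi/2} t \<partial>lborel) = ennreal (Beta ((m + 1) / 2) (1 / 2) / 2)"
    using nn_integral_sin_powr_half[OF m] by simp
  have "(\<integral>\<^sup>+t. ?h {pi/2<..pi} t \<partial>lborel) = (\<integral>\<^sup>+t. ?h {pi/2<..pi} (pi - t) \<partial>lborel)"
    by (rule nn_integral_lborel_reflect[symmetric]) (rule meas, simp)
  also have "\<dots> = (\<integral>\<^sup>+t. ?h {0..pi/2} t \<partial>lborel)"
    by (intro nn_integral_cong_AE AE_I[of _ _ "{pi/2}"]) (auto simp: indicator_def)
  finally have 2: "(\<integral>\<^sup>+t. ?h {pi/2<..pi} t \<partial>lborel) = ennreal (Beta ((m + 1) / 2) (1 / 2) / 2)" using 1 by simp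
  have "{0..pi/2} \<union> {pi/2<..pi} = {0..pi}" by auto
  then have 3: "(\<integral>\<^sup>+t. ?h {0..pi} t \<partial>lborel) = ennreal (Beta ((m + 1) / 2) (1 / 2) / 2) + ennreal (Beta ((m + 1) / 2) (1 / 2) / 2)"
    using split[of "{0..pi/2}" "{pi/2<..pi}"] 1 2 by force
  have "(\<integral>\<^sup>+t. ?h {pi<..<2*pi} t \<partial>lborel) = (\<integral>\<^sup>+t. ?h {pi<..<2*pi} (2 * pi - t) \<partial>lborel)"
    by (rule nn_integral_lborel_reflect[symmetric]) (rule meas, simp)
  also have "\<dots> = (\<integral>\<^sup>+t. ?h {0..pi} t \<partial>lborel)"
    by (intro nn_integral_cong_AE AE_I[of _ _ "{0, pi}"]) (auto simp: indicator_def sin_diff emeasure_lborel_countable le_pi_imp_less_2pi)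
  finally have 4: "(\<integral>\<^sup>+t. ?h {pi<..<2*pi} t \<partial>lborel) = (\<integral>\<^sup>+t. ?h {0..pi} t \<partial>lborel)" .
  have "{0..pi} \<union> {pi<..<2*pi} = {0..<2*pi}" by (auto intro: le_pi_imp_less_2pi)
  then have "(\<integral>\<^sup>+t. ?h {0..<2*pi} t \<partial>lborel) = (\<integral>\<^sup>+t. ?h {0..pi} t \<partial>lborel) + (\<integral>\<^sup>+t. ?h {pi<..<2*pi} t \<partial>lborel)"
    using split[of "{0..pi}" "{pi<..<2*pi}"] by force
  moreover have "0 \<le> Beta ((m + 1) / 2) (1 / 2)"
  proof -
    have "0 < (m + 1) / 2" using m by simp
    moreover from this have "0 < (m + 1) / 2 + 1 / 2" by (rule add_pos_pos) simp
    ultimately show ?thesis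
      unfolding Beta_def by (intro divide_nonneg_pos mult_nonneg_nonneg less_imp_le[OF Gamma_real_pos] Gamma_real_pos) auto
  qed
  ultimately show ?thesis unfolding 4 3 by (simp flip: ennreal_plus)
qed


lemma ultraspherical_const_Beta:
  assumes "-1 < m"
  shows "ultraspherical_const m * (2 * Beta ((m + 1) / 2) (1 / 2)) = 1" "0 < ultraspherical_const m"
proof -
  have pos: "0 < Gamma (m / 2 + 1)" "0 < Gamma (1 / 2 :: real)" "0 < Gamma (m / 2 + 1 / 2)"
    using assms by (auto intro!: Gamma_real_pos)
  then show "0 < ultraspherical_const m" by (simp add: ultraspherical_const_def)
  have "(m + 1) / 2 = m / 2 + 1 / 2" "m / 2 + 1 / 2 + 1 / 2 = m / 2 + 1" by (simp_all add: field_simps)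
  then have "Beta ((m + 1) / 2) (1 / 2) = Gamma (m / 2 + 1 / 2) * Gamma (1 / 2) / Gamma (m / 2 + 1)"
    by (simp only: Beta_def)
  then show "ultraspherical_const m * (2 * Beta ((m + 1) / 2) (1 / 2)) = 1"
    using pos by (simp add: ultraspherical_const_def Gamma_one_half_real)
qed

lemma prob_space_ultraspherical:
  assumes "-1 < m"
  shows "prob_space (ultraspherical m)"
proof
  note C = ultraspherical_const_Beta[OF assms]
  have "emeasure (ultraspherical m) (space (ultraspherical m))
    = (\<integral>\<^sup>+t\<in>{0..<2 * pi}. ennreal (ultraspherical_const m * \<bar>sin t\<bar> powr m) * indicator (sphere 0 1) (cis t) \<partial>lborel)"
    using assms by (subst emeasure_ultraspherical) (auto simp: sets_restrict_space intro!: image_eqI[of _ _ UNIV])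
  also have "\<dots> = (\<integral>\<^sup>+t. ennreal (ultraspherical_const m) * ennreal (\<bar>sin t\<bar> powr m * indicator {0..<2 * pi} t) \<partial>lborel)"
    using C(2) by (intro nn_integral_cong) (auto simp: indicator_def ennreal_mult')
  also have "\<dots> = ennreal (ultraspherical_const m) * ennreal (2 * Beta ((m + 1) / 2) (1 / 2))"
    by (subst nn_integral_cmult) (auto simp: nn_integral_abs_sin_powr[OF assms])
  also have "\<dots> = 1"
    using C by (simp add: ennreal_mult'[symmetric])
  finally show "emeasure (ultraspherical m) (space (ultraspherical m)) = 1" .
qed

text \<open>Functions of Re z do not distinguish the two half circles, so the integral folds onto
  [0, pi]. Integrability against the possibly unbounded weight is deduced from boundedness of h (Re
  z) under the probability measure, not from estimates of the density.\<close>

lemma integral_ultraspherical: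
  fixes h :: "real \<Rightarrow> real"
  assumes m: "-1 < m" and h: "continuous_on {-1..1} h"
  shows "set_integrable lborel {0..pi} (\<lambda>t. sin t powr m * h (cos t))"
    and "(\<integral>z. h (Re z) \<partial>ultraspherical m)
      = 2 * ultraspherical_const m * (LBINT t:{0..pi}. sin t powr m * h (cos t))"
proof -
  let ?c = "ultraspherical_const m"
  let ?N = "restrict_space lborel {0..<2 * pi}"
  let ?w = "\<lambda>t. ?c * \<bar>sin t\<bar> powr m"
  note C = ultraspherical_const_Beta[OF m]
  interpret prob_space "ultraspherical m" by (rule prob_space_ultraspherical[OF m])
  have hc: "continuous_on (sphere 0 1) (\<lambda>z. h (Re z))"
    by (rule continuous_on_compose2[OF h]) (use abs_Re_sphere in \<open>force intro!: continuous_intros simp: abs_le_iff\<close>)+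
  have hm: "(\<lambda>z. h (Re z)) \<in> borel_measurable borel_circle"
    by (rule borel_measurable_continuous_on_restrict[OF hc])
  have hm': "(\<lambda>z. h (Re z)) \<in> borel_measurable (ultraspherical m)"
    using hm by (simp cong: measurable_cong_sets)
  have "bounded ((\<lambda>z. h (Re z)) ` sphere 0 1)"
    using hc by (intro compact_imp_bounded compact_continuous_image) auto
  then obtain B where "\<And>z. norm z = 1 \<Longrightarrow> norm (h (Re z)) \<le> B"
    unfolding bounded_iff by force
  then have int: "integrable (ultraspherical m) (\<lambda>z. h (Re z))"
    using hm' by (intro integrable_const_bound[where B = B]) auto
  have cis_circle: "cis \<in> measurable ?N borel_circle"
    by (intro measurable_restrict_space2 measurable_restrict_space1)
       (auto intro!: borel_measurable_continuous_onI continuous_intros)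
  have D: "ultraspherical m = distr (density ?N ?w) borel_circle cis"
    using m by (simp add: ultraspherical_def)
  have cisD: "cis \<in> measurable (density ?N ?w) borel_circle" using cis_circle by simp
  have hcis: "(\<lambda>t. h (cos t)) \<in> borel_measurable ?N"
    using measurable_compose[OF cis_circle hm] by simp
  have wm: "?w \<in> borel_measurable ?N" by (intro measurable_restrict_space1) measurable
  have w0: "AE t in ?N. 0 \<le> ?w t" using C(2) by simp
  let ?F = "\<lambda>t. ?w t * h (cos t)"
  have intF: "integrable lborel (\<lambda>t. indicator {0..<2 * pi} t *\<^sub>R ?F t)"
  proof -
    have "integrable (density ?N ?w) (\<lambda>t. h (Re (cis t)))"
      using int unfolding D by (rule integrable_distr[OF cisD])
    then have "integrable ?N ?F"
      by (subst (asm) integrable_density) (use hcis wm w0 in auto)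
    then show ?thesis by (subst (asm) integrable_restrict_space) auto
  qed
  have val: "(\<integral>z. h (Re z) \<partial>ultraspherical m) = (\<integral>t. indicator {0..<2 * pi} t *\<^sub>R ?F t \<partial>lborel)"
  proof -
    have "(\<integral>z. h (Re z) \<partial>ultraspherical m) = (\<integral>t. h (Re (cis t)) \<partial>density ?N ?w)"
      unfolding D by (rule integral_distr[OF cisD hm])
    also have "\<dots> = (\<integral>t. ?F t \<partial>?N)"
      by (subst integral_density) (use hcis wm w0 in auto)
    also have "\<dots> = (\<integral>t. indicator {0..<2 * pi} t *\<^sub>R ?F t \<partial>lborel)"
      by (rule integral_restrict_space) simp
    finally show ?thesis .
  qed
  have sF: "set_integrable lborel {0..<2 * pi} ?F" using intF by (simp add: set_integrable_def)
  have i1: "set_integrable lborel {0..pi} ?F"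
    by (rule set_integrable_subset[OF sF]) (auto intro: le_pi_imp_less_2pi)
  have i2: "set_integrable lborel {pi<..<2*pi} ?F"
    by (rule set_integrable_subset[OF sF]) auto
  have eqF: "(\<lambda>t. indicator {0..pi} t *\<^sub>R ?F t) = (\<lambda>t. ?c * (indicator {0..pi} t *\<^sub>R (sin t powr m * h (cos t))))"
    by (auto simp: indicator_def sin_ge_zero)
  show "set_integrable lborel {0..pi} (\<lambda>t. sin t powr m * h (cos t))"
    using i1 C(2) unfolding set_integrable_def eqF by simp
  have "{0..pi} \<union> {pi<..<2*pi} = {0..<2*pi}" by (auto intro: le_pi_imp_less_2pi)
  then have "(LBINT t:{0..<2 * pi}. ?F t) = (LBINT t:{0..pi}. ?F t) + (LBINT t:{pi<..<2*pi}. ?F t)"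
    using set_integral_Un[OF _ i1 i2] by (metis disjoint_iff greaterThanLessThan_iff atLeastAtMost_iff linorder_not_le)
  also have "(LBINT t:{pi<..<2*pi}. ?F t) = (\<integral>t. indicator {pi<..<2*pi} (2 * pi - t) *\<^sub>R ?F (2 * pi - t) \<partial>lborel)"
    unfolding set_lebesgue_integral_def by (rule integral_lborel_reflect[symmetric])
  \<comment> \<open>The two indicators differ at t = 0 and t = pi, but there sin t = 0 and 0
    \<open>powr\<close> m = 0, so the integrands agree at every point.\<close>
  also have "\<dots> = (\<integral>t. indicator {0..pi} t *\<^sub>R ?F t \<partial>lborel)"
  proof (rule Bochner_Integration.integral_cong[OF refl])
    fix t :: real
    consider "t = 0" | "t = pi" | "t \<noteq> 0" "t \<noteq> pi" by blast
    then show "indicator {pi<..<2*pi} (2 * pi - t) *\<^sub>R ?F (2 * pi - t) = indicator {0..pi} t *\<^sub>R ?F t"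
      by cases (auto simp: indicator_def sin_diff cos_diff le_pi_imp_less_2pi)
  qed
  also have "(LBINT t:{0..pi}. ?F t) + \<dots> = 2 * ?c * (LBINT t:{0..pi}. sin t powr m * h (cos t))"
    unfolding set_lebesgue_integral_def eqF by simp
  finally show "(\<integral>z. h (Re z) \<partial>ultraspherical m) = 2 * ?c * (LBINT t:{0..pi}. sin t powr m * h (cos t))"
    unfolding val set_lebesgue_integral_def .
qed

text \<open>Reflection is the substitution t -> pi - t. Stein's identity is integration by parts:
  (sin t)^(m+1) v(cos t)^a vanishes at 0 and pi because m + 1 > 0, and \<open>?G\<close> is its
  derivative.\<close>

lemma circle_measure_ultraspherical:
  assumes m: "-1 < m"
  shows "circle_measure (ultraspherical m) m"
proof -
  interpret prob_space "ultraspherical m" by (rule prob_space_ultraspherical[OF m])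
  define v where "v b x = 1 + b\<^sup>2 + 2 * b * x" for b x :: real
  have V: "V b z = v b (Re z)" for b z by (simp add: V_def v_def)
  have v_nonneg: "0 \<le> v b x" if "x \<in> {-1..1}" for b x
  proof -
    have "v b x = (b + x)\<^sup>2 + (1 - x\<^sup>2)" by (simp add: v_def power2_eq_square algebra_simps)
    moreover have "x\<^sup>2 \<le> 1" using that by (simp add: abs_square_le_1 abs_le_iff)
    ultimately show ?thesis by simp
  qed
  have v_pos: "0 < v b x" if "x \<in> {-1..1}" "0 \<le> b" "b < 1" for b x
  proof -
    have "b * (-1) \<le> b * x" using that by (intro mult_left_mono) auto
    then have "(1 - b)\<^sup>2 \<le> v b x" by (simp add: v_def power2_eq_square algebra_simps)
    moreover have "0 < (1 - b)\<^sup>2" using that by simp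
    ultimately show ?thesis by linarith
  qed
  have v_cont: "continuous_on S (v b)" for S b unfolding v_def by (intro continuous_intros)
  show ?thesis
  proof
    show "sets (ultraspherical m) = sets borel_circle" by simp
    show "- 1 \<le> m" using m by simp
  next
    fix a b :: real assume a: "0 < a"
    have cont: "continuous_on {-1..1} (\<lambda>x. v b x powr a)" for b
      using a by (intro continuous_on_powr' v_cont continuous_intros) (auto intro: v_nonneg)
    have "(LBINT t:{0..pi}. sin t powr m * v (- b) (cos t) powr a)
      = (\<integral>t. indicator {0..pi} (pi - t) *\<^sub>R (sin (pi - t) powr m * v (- b) (cos (pi - t)) powr a) \<partial>lborel)"
      unfolding set_lebesgue_integral_def by (rule integral_lborel_reflect[symmetric])
    also have "\<dots> = (LBINT t:{0..pi}. sin t powr m * v b (cos t) powr a)"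
      unfolding set_lebesgue_integral_def
      by (intro Bochner_Integration.integral_cong refl) (auto simp: indicator_def v_def)
    finally show "(\<integral>z. V (- b) z powr a \<partial>ultraspherical m) = (\<integral>z. V b z powr a \<partial>ultraspherical m)"
      unfolding V using integral_ultraspherical(2)[OF m cont] by simp
  next
    fix a b :: real assume b: "0 \<le> b" "b < 1"
    let ?h1 = "\<lambda>x. x * v b x powr a" and ?h2 = "\<lambda>x. (1 - x\<^sup>2) * v b x powr (a - 1)"
    have vne: "\<forall>x\<in>{-1..1}. v b x \<noteq> 0" using v_pos b by force
    have c1: "continuous_on {-1..1} ?h1" and c2: "continuous_on {-1..1} ?h2"
      using vne by (auto intro!: continuous_intros v_cont)
    note I1 = integral_ultraspherical[OF m c1] and I2 = integral_ultraspherical[OF m c2]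
    have vc: "0 < v b (cos t)" for t using v_pos[of "cos t" b] b by simp
    let ?G = "\<lambda>t. (m + 1) * (sin t powr m * ?h1 (cos t)) - 2 * a * b * (sin t powr m * ?h2 (cos t))"
    \<comment> \<open>For m < 0 the power (sin t)^(m+1) need not be differentiable at the ends, so
      the fundamental theorem is used with continuity on [0, pi] and derivatives only
      inside.\<close>
    have "(?G has_integral (sin pi powr (m + 1) * v b (cos pi) powr a - sin 0 powr (m + 1) * v b (cos 0) powr a)) {0..pi}"
    proof (rule fundamental_theorem_of_calculus_interior)
      show "continuous_on {0..pi} (\<lambda>t. sin t powr (m + 1) * v b (cos t) powr a)"
        using m vc by (intro continuous_on_mult continuous_on_powr' continuous_intros continuous_on_compose2[OF v_cont])
          (auto intro: sin_ge_zero simp: less_imp_neq[THEN not_sym])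
      fix t assume "t \<in> {0<..<pi}"
      then have s: "0 < sin t" by (simp add: sin_gt_zero)
      have d: "((\<lambda>t. v b (cos t)) has_real_derivative - (2 * b * sin t)) (at t)"
        unfolding v_def by (auto intro!: derivative_eq_intros)
      have d1: "((\<lambda>t. sin t powr (m + 1)) has_real_derivative (m + 1) * sin t powr m * cos t) (at t)"
        using DERIV_fun_powr[OF DERIV_sin s, of "m + 1"] by simp
      have d2: "((\<lambda>t. v b (cos t) powr a) has_real_derivative a * v b (cos t) powr (a - 1) * - (2 * b * sin t)) (at t)"
        using DERIV_fun_powr[OF d vc, of a] by simp
      have "((\<lambda>t. sin t powr (m + 1) * v b (cos t) powr a) has_real_derivative
        ((m + 1) * sin t powr m * cos t) * v b (cos t) powr a + (a * v b (cos t) powr (a - 1) * - (2 * b * sin t)) * sin t powr (m + 1)) (at t)"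
        by (rule DERIV_mult[OF d1 d2])
      also have "((m + 1) * sin t powr m * cos t) * v b (cos t) powr a + (a * v b (cos t) powr (a - 1) * - (2 * b * sin t)) * sin t powr (m + 1) = ?G t"
        unfolding sin_squared_eq[symmetric]
        using s by (simp add: powr_add power2_eq_square algebra_simps)
      finally show "((\<lambda>t. sin t powr (m + 1) * v b (cos t) powr a) has_vector_derivative ?G t) (at t)"
        by (simp add: has_real_derivative_iff_has_vector_derivative)
    qed simp
    then have "integral {0..pi} ?G = 0" using m by (simp add: integral_unique)
    moreover have "set_integrable lborel {0..pi} ?G"
      using I1(1) I2(1) by (intro set_integral_diff set_integrable_mult_right) auto
    ultimately have "(LBINT t:{0..pi}. ?G t) = 0" by (simp add: set_borel_integral_eq_integral)
    moreover have "(LBINT t:{0..pi}. ?G t) = (m + 1) * (LBINT t:{0..pi}. sin t powr m * ?h1 (cos t)) - 2 * a * b * (LBINT t:{0..pi}. sin t powr m * ?h2 (cos t))"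
      using I1(1) I2(1) by (subst set_integral_diff(2)) (auto intro!: set_integrable_mult_right)
    ultimately show "(m + 1) * (\<integral>z. Re z * V b z powr a \<partial>ultraspherical m) = 2 * a * b * (\<integral>z. (1 - (Re z)\<^sup>2) * V b z powr (a - 1) \<partial>ultraspherical m)"
      unfolding V I1(2) I2(2) by (simp add: algebra_simps)
  qed
qed

theorem theorem3p1:
  fixes m p q r :: real
  assumes "m \<ge> -1" and "6 \<le> p" and "p \<le> q"
  shows "(\<forall>b::real.
            Lnorm q (ultraspherical m) (\<lambda>z. 1 + complex_of_real r * complex_of_real b * z)
              \<le> Lnorm p (ultraspherical m) (\<lambda>z. 1 + complex_of_real b * z))
         \<longleftrightarrow> \<bar>r\<bar> \<le> sqrt ((p + m) / (q + m))"
proof -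
  interpret circle_measure "ultraspherical m" m
    using circle_measure_minus_one circle_measure_ultraspherical[of m] assms(1) by (cases "m = -1") auto
  have Lnorm: "Lnorm s (ultraspherical m) (\<lambda>z. 1 + complex_of_real b * z) = A (s / 2) b powr (1 / s)" for s b
  proof -
    have "norm (1 + complex_of_real b * z) powr s = V b z powr (s / 2)" if "norm z = 1" for z
      by (simp add: V_eq_norm[OF that] powr_powr flip: powr_numeral)
    then show ?thesis
      unfolding Lnorm_def A_def
      by (intro arg_cong[where f = "\<lambda>x. x powr (1 / s)"] Bochner_Integration.integral_cong refl) simp
  qed
  have "complex_of_real r * complex_of_real b = complex_of_real (r * b)" for b by simp
  then have "(\<forall>b. Lnorm q (ultraspherical m) (\<lambda>z. 1 + complex_of_real r * complex_of_real b * z)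
              \<le> Lnorm p (ultraspherical m) (\<lambda>z. 1 + complex_of_real b * z))
    \<longleftrightarrow> (\<forall>b. A (q / 2) (r * b) powr (1 / q) \<le> A (p / 2) b powr (1 / p))"
    by (simp only: Lnorm)
  also have "\<dots> \<longleftrightarrow> \<bar>r\<bar> \<le> sqrt ((p + m) / (q + m))"
    using hypercontractive[of p q r] hypercontractive_necessary[of p q r] assms by auto
  finally show ?thesis .
qed

end
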